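(* Let $R$ be a ring, $M$ a right $R$-module, and $N\ge 0$ an integer. For an integer $n\geq 1$ consider the condition $(E_n)$: for every $n\times (n-1)$ matrix $X$ over $R$ whose top $(n-1)\times (n-1)$ block is $M$-invertible, and every column vector $y\in R^n$, the action of $y$ either annihilates the kernel $K$ of the additive group homomorphism $M^n\to M^{n-1}$ induced by $X$, or maps $K$ bijectively onto $M$. Suppose $(E_n)$ holds for all $0<n\le N$. Then for all $n\le N$ the following holds: there do not exist an $n\times (n-1)$ matrix $A$ over $R$, and $n\times n$ matrices $B$, $C$ over $R$, each obtained by adding a single column to $A$, such that $$\mathrm{ann}_{M^n}(A)\supsetneqq \mathrm{ann}_{M^n}(B)\supsetneqq \mathrm{ann}_{M^n}(C).$$ Hence if $(E_n)$ holds for all $n>0$, and the $R$-module $M$ is nonzero and faithful, then $R$ admits an embedding in a division ring.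
   Context: Rings are associative with $1$, not necessarily commutative; ring homomorphisms preserve $1$; modules are unital. An embedding in a division ring is an injective ring homomorphism into a division ring. Elements of $M^n$ are row vectors and elements of $R^n$ are column vectors. An $n\times n'$ matrix over $R$ acts on the right, inducing an additive group homomorphism $M^n\to M^{n'}$, $a\mapsto aA$; a column vector $y\in R^n$ induces the map $M^n\to M$, $a\mapsto ay=\sum_i a_iy_i$. An $n\times n$ matrix over $R$ is called $M$-invertible if it induces an invertible (bijective) map $M^n\to M^n$ (the empty $0\times 0$ matrix is $M$-invertible). For a matrix $A$ over $R$ with $n$ rows, $\mathrm{ann}_{M^n}(A)=\{a\in M^n\mid aA=0\}$. For $n=1$, an $n\times(n-1)$ matrix is the empty $1\times 0$ matrix, whose kernel/annihilator is all of $M$. For $n=0$ the conclusion about $A,B,C$ is vacuous. *)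

theory Defs
  imports "HOL-Algebra.Ring" "Jordan_Normal_Form.Matrix"
begin

text \<open>
  \<^locale>\<open>module\<close> is restricted to commutative rings with the scalar on the left, so right
  modules over an arbitrary ring are introduced here in the same style.  As for
  \<^locale>\<open>module\<close>, the multiplicative fields of the underlying ring record are unused.
\<close>

record ('a, 'b) rmodule = "'b ring" +
  rsmult :: "['b, 'a] \<Rightarrow> 'b" (infixl \<open>\<star>\<index>\<close> 70)

locale right_module = R?: ring R + M?: abelian_group M for R (structure) and M (structure) +
  assumes rsmult_closed [simp, intro]:
      "\<lbrakk>x \<in> carrier M; r \<in> carrier R\<rbrakk> \<Longrightarrow> x \<star>\<^bsub>M\<^esub> r \<in> carrier M"
    and rsmult_l_distr:
      "\<lbrakk>x \<in> carrier M; y \<in> carrier M; r \<in> carrier R\<rbrakk> \<Longrightarrow>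
        (x \<oplus>\<^bsub>M\<^esub> y) \<star>\<^bsub>M\<^esub> r = x \<star>\<^bsub>M\<^esub> r \<oplus>\<^bsub>M\<^esub> y \<star>\<^bsub>M\<^esub> r"
    and rsmult_r_distr:
      "\<lbrakk>x \<in> carrier M; r \<in> carrier R; s \<in> carrier R\<rbrakk> \<Longrightarrow>
        x \<star>\<^bsub>M\<^esub> (r \<oplus>\<^bsub>R\<^esub> s) = x \<star>\<^bsub>M\<^esub> r \<oplus>\<^bsub>M\<^esub> x \<star>\<^bsub>M\<^esub> s"
    and rsmult_assoc:
      "\<lbrakk>x \<in> carrier M; r \<in> carrier R; s \<in> carrier R\<rbrakk> \<Longrightarrow>
        x \<star>\<^bsub>M\<^esub> (r \<otimes>\<^bsub>R\<^esub> s) = (x \<star>\<^bsub>M\<^esub> r) \<star>\<^bsub>M\<^esub> s"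
    and rsmult_one [simp]:
      "x \<in> carrier M \<Longrightarrow> x \<star>\<^bsub>M\<^esub> \<one>\<^bsub>R\<^esub> = x"

definition faithful_right_module ::
    "('a, 'p) ring_scheme \<Rightarrow> ('a, 'b, 'q) rmodule_scheme \<Rightarrow> bool" where
  "faithful_right_module R M \<longleftrightarrow>
    (\<forall>r\<in>carrier R. (\<forall>x\<in>carrier M. x \<star>\<^bsub>M\<^esub> r = \<zero>\<^bsub>M\<^esub>) \<longrightarrow> r = \<zero>\<^bsub>R\<^esub>)"


text \<open>
  Vectors and matrices with entries in the carrier.  The type of vectors does not
  distinguish rows from columns; indices start at 0.
\<close>

definition vecs_over :: "('a, 'p) ring_scheme \<Rightarrow> nat \<Rightarrow> 'a vec set" where
  "vecs_over S n = {v \<in> carrier_vec n. \<forall>i<n. v $ i \<in> carrier S}"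

definition mats_over :: "('a, 'p) ring_scheme \<Rightarrow> nat \<Rightarrow> nat \<Rightarrow> 'a mat set" where
  "mats_over S n m = {A \<in> carrier_mat n m. \<forall>i<n. \<forall>j<m. A $$ (i, j) \<in> carrier S}"

definition vec_action :: "('a, 'b, 'q) rmodule_scheme \<Rightarrow> 'b vec \<Rightarrow> 'a vec \<Rightarrow> 'b" where
  "vec_action M a y = (\<Oplus>\<^bsub>M\<^esub>i\<in>{..<dim_vec y}. (a $ i) \<star>\<^bsub>M\<^esub> (y $ i))"

definition mat_action :: "('a, 'b, 'q) rmodule_scheme \<Rightarrow> 'b vec \<Rightarrow> 'a mat \<Rightarrow> 'b vec" where
  "mat_action M a A = vec (dim_col A) (\<lambda>j. vec_action M a (col A j))"

text \<open>The annihilator of \<open>A\<close> in $M^n$, where \<open>n\<close> is the number of rows of \<open>A\<close>.\<close>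

definition ann_mat :: "('a, 'b, 'q) rmodule_scheme \<Rightarrow> 'a mat \<Rightarrow> 'b vec set" where
  "ann_mat M A =
    {a \<in> vecs_over M (dim_row A). mat_action M a A = vec (dim_col A) (\<lambda>_. \<zero>\<^bsub>M\<^esub>)}"

definition M_invertible :: "('a, 'b, 'q) rmodule_scheme \<Rightarrow> nat \<Rightarrow> 'a mat \<Rightarrow> bool" where
  "M_invertible M n A \<longleftrightarrow> A \<in> carrier_mat n n \<and>
    bij_betw (\<lambda>a. mat_action M a A) (vecs_over M n) (vecs_over M n)"

definition top_block :: "nat \<Rightarrow> 'a mat \<Rightarrow> 'a mat" where
  "top_block k X = mat k k (\<lambda>(i, j). X $$ (i, j))"

text \<open>Only used for \<open>n \<ge> 1\<close>.\<close>

definition E_condition ::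
    "('a, 'p) ring_scheme \<Rightarrow> ('a, 'b, 'q) rmodule_scheme \<Rightarrow> nat \<Rightarrow> bool" where
  "E_condition R M n \<longleftrightarrow>
    (\<forall>X \<in> mats_over R n (n - 1). M_invertible M (n - 1) (top_block (n - 1) X) \<longrightarrow>
      (\<forall>y \<in> vecs_over R n.
        (\<forall>a \<in> ann_mat M X. vec_action M a y = \<zero>\<^bsub>M\<^esub>) \<or>
        bij_betw (\<lambda>a. vec_action M a y) (ann_mat M X) (carrier M)))"

text \<open>
  \<open>B\<close> arises from \<open>A\<close> by inserting one column, at any position \<open>k\<close>; equivalently, deleting
  column \<open>k\<close> of \<open>B\<close> leaves \<open>A\<close>.
\<close>

definition adds_column :: "'a mat \<Rightarrow> 'a mat \<Rightarrow> bool" where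
  "adds_column A B \<longleftrightarrow> dim_row B = dim_row A \<and> dim_col B = Suc (dim_col A) \<and>
    (\<exists>k < dim_col B. A = mat (dim_row B) (dim_col B - 1)
        (\<lambda>(i, j). B $$ (i, if j < k then j else Suc j)))"

locale skew_field = ring D for D (structure) +
  assumes one_not_zero: "\<one> \<noteq> \<zero>"
    and nonzero_Units: "Units D = carrier D - {\<zero>}"

text \<open>
  HOL cannot quantify over types inside a formula, so the elements of the division ring have
  to be taken from a fixed type.  Choosing lists over the element type of \<open>R\<close> loses nothing:
  the division subring generated by the image of \<open>R\<close> under an embedding into any division ring
  has cardinality at most $\max(|R|, \aleph_0)$, so an isomorphic copy of it lives on this type.
\<close>

definition embeds_in_division_ring :: "('a, 'p) ring_scheme \<Rightarrow> bool" where
  "embeds_in_division_ring R \<longleftrightarrow>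
    (\<exists>(D :: 'a list ring) h. skew_field D \<and> h \<in> ring_hom R D \<and> inj_on h (carrier R))"

end

theory Submission
  imports Defs "HOL-Algebra.Weak_Morphisms"
begin

text \<open>
  Condition $(E_n)$ says that an $M$-invertible square block, extended by one row and one
  column, either stays $M$-invertible or the new column vanishes on the annihilator of the old
  ones.  Hence a maximal $M$-invertible block of \<open>A\<close> uses columns with the same annihilator as
  \<open>A\<close>.  In a chain of annihilators one could extend this block by both added columns \<open>b\<close> and \<open>c\<close>,
  so some vector is killed by \<open>A\<close> and \<open>c\<close> but not by \<open>b\<close>, contradicting
  $\mathrm{ann}(C) \subseteq \mathrm{ann}(B)$.

  For the embedding, no matrix ideals are needed: the division ring is the rational closure of the
  image of \<open>R\<close> in the ring of additive endomorphisms of \<open>M\<close> (acting on the right), that is, the set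
  of all $d = r - u A^{-1} v$ with \<open>A\<close> an $M$-invertible matrix, \<open>u\<close> a row and \<open>v\<close> a column
  over \<open>R\<close>.  On the kernel of the matrix with blocks \<open>A\<close> and \<open>u\<close>, which is a copy of \<open>M\<close>, the
  column with blocks \<open>v\<close> and \<open>r\<close> acts as \<open>d\<close>.  So $(E_n)$ says that \<open>d\<close> is zero or bijective, and
  in the latter case the whole bordered matrix is $M$-invertible, which puts $d^{-1}$ in the
  rational closure as well.
\<close>

context right_module
begin

section \<open>Linear combinations and invertible blocks\<close>

lemma rsmult_zero_left [simp]:
  assumes "r \<in> carrier R" shows "\<zero>\<^bsub>M\<^esub> \<star>\<^bsub>M\<^esub> r = \<zero>\<^bsub>M\<^esub>"
proof -
  have "\<zero>\<^bsub>M\<^esub> \<star>\<^bsub>M\<^esub> r \<oplus>\<^bsub>M\<^esub> \<zero>\<^bsub>M\<^esub> \<star>\<^bsub>M\<^esub> r = \<zero>\<^bsub>M\<^esub> \<star>\<^bsub>M\<^esub> r"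
    using assms rsmult_l_distr[of "\<zero>\<^bsub>M\<^esub>" "\<zero>\<^bsub>M\<^esub>" r] by simp
  then show ?thesis
    using assms by (metis M.zero_closed rsmult_closed M.add.r_cancel_one)
qed

lemma rsmult_zero_right [simp]:
  assumes "x \<in> carrier M" shows "x \<star>\<^bsub>M\<^esub> \<zero>\<^bsub>R\<^esub> = \<zero>\<^bsub>M\<^esub>"
proof -
  have "x \<star>\<^bsub>M\<^esub> \<zero>\<^bsub>R\<^esub> \<oplus>\<^bsub>M\<^esub> x \<star>\<^bsub>M\<^esub> \<zero>\<^bsub>R\<^esub> = x \<star>\<^bsub>M\<^esub> \<zero>\<^bsub>R\<^esub>"
    using assms rsmult_r_distr[of x "\<zero>\<^bsub>R\<^esub>" "\<zero>\<^bsub>R\<^esub>"] by simp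
  then show ?thesis
    using assms by (metis R.zero_closed rsmult_closed M.add.r_cancel_one)
qed

lemma rsmult_minus_right:
  assumes "x \<in> carrier M" "r \<in> carrier R"
  shows "x \<star>\<^bsub>M\<^esub> (\<ominus>\<^bsub>R\<^esub> r) = \<ominus>\<^bsub>M\<^esub> (x \<star>\<^bsub>M\<^esub> r)"
proof -
  have "x \<star>\<^bsub>M\<^esub> (\<ominus>\<^bsub>R\<^esub> r) \<oplus>\<^bsub>M\<^esub> x \<star>\<^bsub>M\<^esub> r = \<zero>\<^bsub>M\<^esub>"
    using assms rsmult_r_distr[of x "\<ominus>\<^bsub>R\<^esub> r" r] by (simp add: R.l_neg)
  then show ?thesis
    using assms by (metis R.a_inv_closed M.minus_equality rsmult_closed)
qed

text \<open>Index sets of any type, with plain functions as vectors, make it possible to select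
  rows, to adjoin a row, or to join two systems along a disjoint sum without renumbering.\<close>

definition comb :: "'i set \<Rightarrow> ('i \<Rightarrow> 'c) \<Rightarrow> ('i \<Rightarrow> 'a) \<Rightarrow> 'c" where
  "comb I a y = (\<Oplus>\<^bsub>M\<^esub>i\<in>I. a i \<star>\<^bsub>M\<^esub> y i)"

lemma comb_closed [simp, intro]:
  assumes "\<And>i. i \<in> I \<Longrightarrow> a i \<in> carrier M" "\<And>i. i \<in> I \<Longrightarrow> y i \<in> carrier R"
  shows "comb I a y \<in> carrier M"
  unfolding comb_def using assms by (intro M.finsum_closed) auto

lemma comb_cong:
  assumes "I = I'" "\<And>i. i \<in> I' \<Longrightarrow> a i = a' i" "\<And>i. i \<in> I' \<Longrightarrow> y i = y' i"
    and "\<And>i. i \<in> I' \<Longrightarrow> a' i \<in> carrier M" "\<And>i. i \<in> I' \<Longrightarrow> y' i \<in> carrier R"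
  shows "comb I a y = comb I' a' y'"
  unfolding comb_def using assms by (intro M.finsum_cong') auto

lemma comb_empty [simp]: "comb {} a y = \<zero>\<^bsub>M\<^esub>"
  unfolding comb_def by (simp add: M.finsum_empty)

lemma comb_insert:
  assumes "finite I" "i \<notin> I"
    and "\<And>j. j \<in> insert i I \<Longrightarrow> a j \<in> carrier M" "\<And>j. j \<in> insert i I \<Longrightarrow> y j \<in> carrier R"
  shows "comb (insert i I) a y = a i \<star>\<^bsub>M\<^esub> y i \<oplus>\<^bsub>M\<^esub> comb I a y"
  unfolding comb_def using assms by (intro M.finsum_insert) auto

lemma comb_Un_disjoint:
  assumes "finite I" "finite K" "I \<inter> K = {}"
    and "\<And>j. j \<in> I \<union> K \<Longrightarrow> a j \<in> carrier M" "\<And>j. j \<in> I \<union> K \<Longrightarrow> y j \<in> carrier R"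
  shows "comb (I \<union> K) a y = comb I a y \<oplus>\<^bsub>M\<^esub> comb K a y"
  unfolding comb_def using assms by (intro M.finsum_Un_disjoint) auto

lemma comb_eq_zero:
  assumes "\<And>i. i \<in> I \<Longrightarrow> a i \<star>\<^bsub>M\<^esub> y i = \<zero>\<^bsub>M\<^esub>"
  shows "comb I a y = \<zero>\<^bsub>M\<^esub>"
proof -
  have "comb I a y = (\<Oplus>\<^bsub>M\<^esub>i\<in>I. \<zero>\<^bsub>M\<^esub>)"
    unfolding comb_def using assms by (intro M.finsum_cong') auto
  then show ?thesis by (simp add: M.finsum_zero)
qed

lemma comb_single:
  assumes "finite I" "i \<in> I" "\<And>j. j \<in> I \<Longrightarrow> a j \<in> carrier M" "\<And>j. j \<in> I \<Longrightarrow> y j \<in> carrier R"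
    and "\<And>j. j \<in> I \<Longrightarrow> j \<noteq> i \<Longrightarrow> a j \<star>\<^bsub>M\<^esub> y j = \<zero>\<^bsub>M\<^esub>"
  shows "comb I a y = a i \<star>\<^bsub>M\<^esub> y i"
proof -
  have "comb (insert i (I - {i})) a y = a i \<star>\<^bsub>M\<^esub> y i \<oplus>\<^bsub>M\<^esub> comb (I - {i}) a y"
    using assms by (intro comb_insert) auto
  moreover have "comb (I - {i}) a y = \<zero>\<^bsub>M\<^esub>"
    using assms by (intro comb_eq_zero) auto
  ultimately show ?thesis using assms by (simp add: insert_absorb)
qed

lemma comb_mono_neutral:
  assumes "finite K" "I \<subseteq> K"
    and "\<And>j. j \<in> K \<Longrightarrow> a j \<in> carrier M" "\<And>j. j \<in> K \<Longrightarrow> y j \<in> carrier R"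
    and "\<And>j. j \<in> K - I \<Longrightarrow> a j \<star>\<^bsub>M\<^esub> y j = \<zero>\<^bsub>M\<^esub>"
  shows "comb K a y = comb I a y"
proof -
  have "comb (I \<union> (K - I)) a y = comb I a y \<oplus>\<^bsub>M\<^esub> comb (K - I) a y"
    using assms finite_subset[of I K] by (intro comb_Un_disjoint) auto
  moreover have "comb (K - I) a y = \<zero>\<^bsub>M\<^esub>"
    using assms by (intro comb_eq_zero) auto
  moreover have "comb I a y \<in> carrier M"
    using assms by (intro comb_closed) auto
  moreover have "I \<union> (K - I) = K" using assms by auto
  ultimately show ?thesis by simp
qed

lemma comb_add_left:
  assumes "\<And>i. i \<in> I \<Longrightarrow> a i \<in> carrier M" "\<And>i. i \<in> I \<Longrightarrow> b i \<in> carrier M"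
    and "\<And>i. i \<in> I \<Longrightarrow> y i \<in> carrier R"
  shows "comb I (\<lambda>i. a i \<oplus>\<^bsub>M\<^esub> b i) y = comb I a y \<oplus>\<^bsub>M\<^esub> comb I b y"
proof -
  have "comb I (\<lambda>i. a i \<oplus>\<^bsub>M\<^esub> b i) y = (\<Oplus>\<^bsub>M\<^esub>i\<in>I. a i \<star>\<^bsub>M\<^esub> y i \<oplus>\<^bsub>M\<^esub> b i \<star>\<^bsub>M\<^esub> y i)"
    unfolding comb_def using assms by (intro M.finsum_cong') (auto simp: rsmult_l_distr)
  also have "\<dots> = comb I a y \<oplus>\<^bsub>M\<^esub> comb I b y"
    unfolding comb_def using assms by (intro M.finsum_addf) auto
  finally show ?thesis .
qed

lemma comb_minus_left:
  assumes "\<And>i. i \<in> I \<Longrightarrow> a i \<in> carrier M" "\<And>i. i \<in> I \<Longrightarrow> y i \<in> carrier R"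
  shows "comb I (\<lambda>i. \<ominus>\<^bsub>M\<^esub> a i) y = \<ominus>\<^bsub>M\<^esub> comb I a y"
proof -
  have "comb I (\<lambda>i. \<ominus>\<^bsub>M\<^esub> a i) y \<oplus>\<^bsub>M\<^esub> comb I a y = comb I (\<lambda>i. \<ominus>\<^bsub>M\<^esub> a i \<oplus>\<^bsub>M\<^esub> a i) y"
    using assms by (intro comb_add_left[symmetric]) auto
  also have "\<dots> = \<zero>\<^bsub>M\<^esub>"
    using assms by (intro comb_eq_zero) (auto simp: M.l_neg)
  finally show ?thesis
    using assms by (intro M.minus_equality[symmetric]) auto
qed

lemma comb_diff_left:
  assumes "\<And>i. i \<in> I \<Longrightarrow> a i \<in> carrier M" "\<And>i. i \<in> I \<Longrightarrow> b i \<in> carrier M"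
    and "\<And>i. i \<in> I \<Longrightarrow> y i \<in> carrier R"
  shows "comb I (\<lambda>i. a i \<ominus>\<^bsub>M\<^esub> b i) y = comb I a y \<ominus>\<^bsub>M\<^esub> comb I b y"
  unfolding M.minus_eq using assms by (simp add: comb_add_left comb_minus_left)

lemma comb_reindex:
  assumes "inj_on h I" "\<And>i. i \<in> I \<Longrightarrow> a (h i) \<in> carrier M" "\<And>i. i \<in> I \<Longrightarrow> y (h i) \<in> carrier R"
  shows "comb (h ` I) a y = comb I (\<lambda>i. a (h i)) (\<lambda>i. y (h i))"
  unfolding comb_def using assms by (intro M.finsum_reindex) auto

lemma comb_Plus:
  assumes "finite I" "finite K"
    and "\<And>i. i \<in> I \<Longrightarrow> a (Inl i) \<in> carrier M" "\<And>i. i \<in> K \<Longrightarrow> a (Inr i) \<in> carrier M"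
    and "\<And>i. i \<in> I \<Longrightarrow> y (Inl i) \<in> carrier R" "\<And>i. i \<in> K \<Longrightarrow> y (Inr i) \<in> carrier R"
  shows "comb (I <+> K) a y =
    comb I (\<lambda>i. a (Inl i)) (\<lambda>i. y (Inl i)) \<oplus>\<^bsub>M\<^esub> comb K (\<lambda>i. a (Inr i)) (\<lambda>i. y (Inr i))"
proof -
  have "comb (Inl ` I \<union> Inr ` K) a y = comb (Inl ` I) a y \<oplus>\<^bsub>M\<^esub> comb (Inr ` K) a y"
    using assms by (intro comb_Un_disjoint) auto
  then show ?thesis
    using assms by (simp add: Plus_def comb_reindex)
qed

lemma vec_action_eq_comb:
  assumes "dim_vec y = n"
  shows "vec_action M a y = comb {..<n} (\<lambda>i. a $ i) (\<lambda>i. y $ i)"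
  using assms by (simp add: vec_action_def comb_def)

text \<open>This is $M$-invertibility of the block with rows \<open>I\<close> and columns
  \<open>J\<close>: the first clause is surjectivity, the second is injectivity, stated as a trivial
  kernel because \<open>comb\<close> is additive. Functions matter only on \<open>I\<close> and
  \<open>J\<close>, so vanishing is asserted pointwise there. The two index sets may have different
  types.\<close>

definition nonsing :: "'i set \<Rightarrow> 'j set \<Rightarrow> ('i \<Rightarrow> 'j \<Rightarrow> 'a) \<Rightarrow> bool" where
  "nonsing I J A \<longleftrightarrow>
    (\<forall>t\<in>J \<rightarrow> carrier M. \<exists>a\<in>I \<rightarrow> carrier M. \<forall>j\<in>J. comb I a (\<lambda>i. A i j) = t j) \<and>
    (\<forall>a\<in>I \<rightarrow> carrier M. (\<forall>j\<in>J. comb I a (\<lambda>i. A i j) = \<zero>\<^bsub>M\<^esub>) \<longrightarrow> (\<forall>i\<in>I. a i = \<zero>\<^bsub>M\<^esub>))"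

lemma nonsing_solve:
  assumes "nonsing I J A" "\<And>j. j \<in> J \<Longrightarrow> t j \<in> carrier M"
  obtains a where "\<And>i. i \<in> I \<Longrightarrow> a i \<in> carrier M" "\<And>j. j \<in> J \<Longrightarrow> comb I a (\<lambda>i. A i j) = t j"
proof -
  have "t \<in> J \<rightarrow> carrier M" using assms by auto
  then obtain a where "a \<in> I \<rightarrow> carrier M" "\<forall>j\<in>J. comb I a (\<lambda>i. A i j) = t j"
    using assms(1) unfolding nonsing_def by blast
  then show thesis using that by blast
qed

lemma nonsing_kernel:
  assumes "nonsing I J A" "\<And>i. i \<in> I \<Longrightarrow> a i \<in> carrier M"
    and "\<And>j. j \<in> J \<Longrightarrow> comb I a (\<lambda>i. A i j) = \<zero>\<^bsub>M\<^esub>" "i \<in> I"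
  shows "a i = \<zero>\<^bsub>M\<^esub>"
  using assms unfolding nonsing_def by (metis Pi_I)

lemma nonsing_empty: "nonsing {} {} A"
  unfolding nonsing_def by auto

lemma nonsing_cong:
  assumes "nonsing I J A" "\<And>i j. i \<in> I \<Longrightarrow> j \<in> J \<Longrightarrow> A i j \<in> carrier R"
    and "\<And>i j. i \<in> I \<Longrightarrow> j \<in> J \<Longrightarrow> A' i j = A i j"
  shows "nonsing I J A'"
proof -
  have eq: "comb I a (\<lambda>i. A' i j) = comb I a (\<lambda>i. A i j)" if "a \<in> I \<rightarrow> carrier M" "j \<in> J" for a j
    using assms that by (intro comb_cong) auto
  show ?thesis unfolding nonsing_def
  proof (intro conjI ballI impI)
    fix t assume "t \<in> J \<rightarrow> carrier M"
    then obtain a where "a \<in> I \<rightarrow> carrier M" "\<forall>j\<in>J. comb I a (\<lambda>i. A i j) = t j"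
      using assms(1) unfolding nonsing_def by blast
    then show "\<exists>a\<in>I \<rightarrow> carrier M. \<forall>j\<in>J. comb I a (\<lambda>i. A' i j) = t j"
      using eq by auto
  next
    fix a i assume a: "a \<in> I \<rightarrow> carrier M" "\<forall>j\<in>J. comb I a (\<lambda>i. A' i j) = \<zero>\<^bsub>M\<^esub>" and i: "i \<in> I"
    show "a i = \<zero>\<^bsub>M\<^esub>"
      using nonsing_kernel[OF assms(1) _ _ i, of a] a eq[OF a(1)] by auto
  qed
qed

text \<open>This allows a block with arbitrary index sets to be numbered by initial segments of the
  naturals, the only blocks that \<open>E_condition\<close> speaks of.\<close>

lemma nonsing_reindex:
  assumes "inj_on h I" "inj_on g J" "\<And>i j. i \<in> I \<Longrightarrow> j \<in> J \<Longrightarrow> A (h i) (g j) \<in> carrier R"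
  shows "nonsing (h ` I) (g ` J) A \<longleftrightarrow> nonsing I J (\<lambda>i j. A (h i) (g j))" (is "?L \<longleftrightarrow> ?R")
proof -
  have eq: "comb (h ` I) a (\<lambda>i. A i (g j)) = comb I (\<lambda>i. a (h i)) (\<lambda>i. A (h i) (g j))"
    if "\<And>i. i \<in> I \<Longrightarrow> a (h i) \<in> carrier M" "j \<in> J" for a j
    using assms that by (intro comb_reindex) auto
  have eq': "comb (h ` I) (\<lambda>i. a (inv_into I h i)) (\<lambda>i. A i (g j)) = comb I a (\<lambda>i. A (h i) (g j))"
    if "\<And>i. i \<in> I \<Longrightarrow> a i \<in> carrier M" "j \<in> J" for a j
  proof -
    have "comb (h ` I) (\<lambda>i. a (inv_into I h i)) (\<lambda>i. A i (g j)) =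
       comb I (\<lambda>i. a (inv_into I h (h i))) (\<lambda>i. A (h i) (g j))"
      using assms(1) that by (intro eq) auto
    also have "\<dots> = comb I a (\<lambda>i. A (h i) (g j))"
      using assms that by (intro comb_cong) auto
    finally show ?thesis .
  qed
  show ?thesis
  proof
    assume L: ?L
    show ?R unfolding nonsing_def
    proof (intro conjI ballI impI)
      fix t assume t: "t \<in> J \<rightarrow> carrier M"
      have "t (inv_into J g j) \<in> carrier M" if "j \<in> g ` J" for j
        using t that inv_into_into[OF that] by auto
      then obtain a where "\<And>i. i \<in> h ` I \<Longrightarrow> a i \<in> carrier M"
        "\<And>j. j \<in> g ` J \<Longrightarrow> comb (h ` I) a (\<lambda>i. A i j) = t (inv_into J g j)"
        using nonsing_solve[OF L, of "\<lambda>j. t (inv_into J g j)"] by blast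
      then show "\<exists>a\<in>I \<rightarrow> carrier M. \<forall>j\<in>J. comb I a (\<lambda>i. A (h i) (g j)) = t j"
        using eq[of a] assms(2) by (intro bexI[of _ "\<lambda>i. a (h i)"]) auto
    next
      fix a i assume a: "a \<in> I \<rightarrow> carrier M" "\<forall>j\<in>J. comb I a (\<lambda>i. A (h i) (g j)) = \<zero>\<^bsub>M\<^esub>" and i: "i \<in> I"
      have "a (inv_into I h (h i)) = \<zero>\<^bsub>M\<^esub>"
        by (rule nonsing_kernel[OF L, of "\<lambda>i. a (inv_into I h i)" "h i"])
          (use a i assms(1) eq'[of a] in auto)
      then show "a i = \<zero>\<^bsub>M\<^esub>" using i assms(1) by simp
    qed
  next
    assume R: ?R
    show ?L unfolding nonsing_def
    proof (intro conjI ballI impI)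
      fix t assume t: "t \<in> g ` J \<rightarrow> carrier M"
      obtain a where "\<And>i. i \<in> I \<Longrightarrow> a i \<in> carrier M"
        "\<And>j. j \<in> J \<Longrightarrow> comb I a (\<lambda>i. A (h i) (g j)) = t (g j)"
        using nonsing_solve[OF R, of "\<lambda>j. t (g j)"] t by auto
      then show "\<exists>a\<in>h ` I \<rightarrow> carrier M. \<forall>j\<in>g ` J. comb (h ` I) a (\<lambda>i. A i j) = t j"
        using eq'[of a] assms(1) by (intro bexI[of _ "\<lambda>i. a (inv_into I h i)"]) auto
    next
      fix a i assume a: "a \<in> h ` I \<rightarrow> carrier M"
        "\<forall>j\<in>g ` J. comb (h ` I) a (\<lambda>i. A i j) = \<zero>\<^bsub>M\<^esub>" and "i \<in> h ` I"
      then obtain i' where i': "i' \<in> I" "i = h i'" by auto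
      have "comb I (\<lambda>i. a (h i)) (\<lambda>i. A (h i) (g j)) = \<zero>\<^bsub>M\<^esub>" if "j \<in> J" for j
        using a that by (subst eq[symmetric]) auto
      then have "a (h i') = \<zero>\<^bsub>M\<^esub>"
        using a(1) i'(1) by (intro nonsing_kernel[OF R, of "\<lambda>i. a (h i)" i']) auto
      then show "a i = \<zero>\<^bsub>M\<^esub>" using i' by simp
    qed
  qed
qed

text \<open>To reach a prescribed \<open>t\<close>, the old block first takes care of the columns in
  \<open>J\<close>, with entry zero in the new row. The error left in column \<open>j\<close> is
  then corrected by an element of the kernel of the old columns, which by \<open>surj\<close> takes
  every value in column \<open>j\<close> and does not disturb the columns in
  \<open>J\<close>.\<close>

lemma nonsing_insert_if_kernel_bij:
  assumes fin: "finite I" "i \<notin> I" "j \<notin> J"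
    and A: "\<And>p q. p \<in> insert i I \<Longrightarrow> q \<in> insert j J \<Longrightarrow> A p q \<in> carrier R"
    and ns: "nonsing I J A"
    and surj: "\<And>m. m \<in> carrier M \<Longrightarrow> \<exists>a. (\<forall>p\<in>insert i I. a p \<in> carrier M) \<and>
      (\<forall>q\<in>J. comb (insert i I) a (\<lambda>p. A p q) = \<zero>\<^bsub>M\<^esub>) \<and> comb (insert i I) a (\<lambda>p. A p j) = m"
    and inj: "\<And>a p. (\<And>p. p \<in> insert i I \<Longrightarrow> a p \<in> carrier M) \<Longrightarrow>
      (\<And>q. q \<in> insert j J \<Longrightarrow> comb (insert i I) a (\<lambda>p. A p q) = \<zero>\<^bsub>M\<^esub>) \<Longrightarrow>
      p \<in> insert i I \<Longrightarrow> a p = \<zero>\<^bsub>M\<^esub>"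
  shows "nonsing (insert i I) (insert j J) A"
  unfolding nonsing_def
proof (intro conjI ballI impI)
  fix t assume t: "t \<in> insert j J \<rightarrow> carrier M"
  have "t q \<in> carrier M" if "q \<in> J" for q using t that by auto
  then obtain a where a: "\<And>p. p \<in> I \<Longrightarrow> a p \<in> carrier M" "\<And>q. q \<in> J \<Longrightarrow> comb I a (\<lambda>p. A p q) = t q"
    using nonsing_solve[OF ns, of t] by blast
  define a' where "a' = a(i := \<zero>\<^bsub>M\<^esub>)"
  have a'_cl: "a' p \<in> carrier M" if "p \<in> insert i I" for p
    using a that fin by (auto simp: a'_def)
  have a'_J: "comb (insert i I) a' (\<lambda>p. A p q) = t q" if "q \<in> J" for q
  proof -
    have "comb (insert i I) a' (\<lambda>p. A p q) = comb I a' (\<lambda>p. A p q)"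
      using fin a'_cl A that by (intro comb_mono_neutral) (auto simp: a'_def)
    also have "\<dots> = comb I a (\<lambda>p. A p q)"
      using fin a A that by (intro comb_cong) (auto simp: a'_def)
    finally show ?thesis using a that by simp
  qed
  have c: "comb (insert i I) a' (\<lambda>p. A p j) \<in> carrier M"
    using a'_cl A by (intro comb_closed) auto
  \<comment> \<open>\<open>b\<close> is the kernel element that makes up the difference between
    \<open>t j\<close> and the value of \<open>a'\<close> in column \<open>j\<close>.\<close>
  then obtain b where b: "\<And>p. p \<in> insert i I \<Longrightarrow> b p \<in> carrier M"
    "\<And>q. q \<in> J \<Longrightarrow> comb (insert i I) b (\<lambda>p. A p q) = \<zero>\<^bsub>M\<^esub>"
    "comb (insert i I) b (\<lambda>p. A p j) = t j \<ominus>\<^bsub>M\<^esub> comb (insert i I) a' (\<lambda>p. A p j)"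
    using surj[of "t j \<ominus>\<^bsub>M\<^esub> comb (insert i I) a' (\<lambda>p. A p j)"] t by auto
  have "comb (insert i I) (\<lambda>p. b p \<oplus>\<^bsub>M\<^esub> a' p) (\<lambda>p. A p q) = t q" if "q \<in> insert j J" for q
  proof -
    have "comb (insert i I) (\<lambda>p. b p \<oplus>\<^bsub>M\<^esub> a' p) (\<lambda>p. A p q) =
      comb (insert i I) b (\<lambda>p. A p q) \<oplus>\<^bsub>M\<^esub> comb (insert i I) a' (\<lambda>p. A p q)"
      using a'_cl b A that by (intro comb_add_left) auto
    also have "\<dots> = t q"
      using that b a'_J t c funcset_mem[OF t that] by (auto simp: M.minus_eq M.a_assoc M.l_neg)
    finally show ?thesis .
  qed
  then show "\<exists>a\<in>insert i I \<rightarrow> carrier M. \<forall>q\<in>insert j J. comb (insert i I) a (\<lambda>p. A p q) = t q"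
    using b(1) a'_cl by (intro bexI[of _ "\<lambda>p. b p \<oplus>\<^bsub>M\<^esub> a' p"]) auto
next
  fix a p assume "a \<in> insert i I \<rightarrow> carrier M"
    "\<forall>q\<in>insert j J. comb (insert i I) a (\<lambda>p. A p q) = \<zero>\<^bsub>M\<^esub>" "p \<in> insert i I"
  then show "a p = \<zero>\<^bsub>M\<^esub>" by (intro inj[of a p]) auto
qed

section \<open>Condition $(E_n)$ for blocks with arbitrary index sets\<close>

lemma M_invertible_if_nonsing:
  assumes T: "T \<in> mats_over R k k" and ns: "nonsing {..<k} {..<k} (\<lambda>i j. T $$ (i, j))"
  shows "M_invertible M k T"
proof -
  have dim: "dim_row T = k" "dim_col T = k"
    and cl: "\<And>i j. i < k \<Longrightarrow> j < k \<Longrightarrow> T $$ (i, j) \<in> carrier R"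
    using T by (auto simp: mats_over_def)
  have act: "vec_action M a (col T j) = comb {..<k} (\<lambda>i. a $ i) (\<lambda>i. T $$ (i, j))"
    if "a \<in> vecs_over M k" "j < k" for a j
    unfolding vec_action_eq_comb[of "col T j" k, OF trans[OF dim_col dim(1)]]
    using that dim cl by (intro comb_cong) (auto simp: vecs_over_def)
  have closed: "mat_action M a T \<in> vecs_over M k" if "a \<in> vecs_over M k" for a
    using that dim cl by (auto simp: mat_action_def vecs_over_def act intro!: comb_closed)
  show ?thesis
    unfolding M_invertible_def
  proof (intro conjI bij_betw_imageI inj_onI)
    show "T \<in> carrier_mat k k" using T by (simp add: mats_over_def)
  next
    fix a b assume a: "a \<in> vecs_over M k" and b: "b \<in> vecs_over M k"
      and eq: "mat_action M a T = mat_action M b T"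
    have a_cl: "a $ i \<in> carrier M" and b_cl: "b $ i \<in> carrier M" if "i < k" for i
      using a b that by (auto simp: vecs_over_def)
    have eq_j: "comb {..<k} (\<lambda>i. a $ i) (\<lambda>i. T $$ (i, j)) = comb {..<k} (\<lambda>i. b $ i) (\<lambda>i. T $$ (i, j))"
      if "j < k" for j
      using arg_cong[OF eq, of "\<lambda>v. v $ j"] that dim a b by (simp add: mat_action_def act)
    have "a $ i \<ominus>\<^bsub>M\<^esub> b $ i = \<zero>\<^bsub>M\<^esub>" if "i < k" for i
    proof (rule nonsing_kernel[OF ns, of "\<lambda>i. a $ i \<ominus>\<^bsub>M\<^esub> b $ i"])
      fix j assume j: "j \<in> {..<k}"
      have "comb {..<k} (\<lambda>i. a $ i \<ominus>\<^bsub>M\<^esub> b $ i) (\<lambda>i. T $$ (i, j)) =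
        comb {..<k} (\<lambda>i. a $ i) (\<lambda>i. T $$ (i, j)) \<ominus>\<^bsub>M\<^esub> comb {..<k} (\<lambda>i. b $ i) (\<lambda>i. T $$ (i, j))"
        using j a_cl b_cl cl by (intro comb_diff_left) auto
      also have "\<dots> = \<zero>\<^bsub>M\<^esub>"
        using j b_cl cl eq_j comb_closed[of "{..<k}" "($) b" "\<lambda>i. T $$ (i, j)"]
        by (simp add: M.minus_eq M.r_neg)
      finally show "comb {..<k} (\<lambda>i. a $ i \<ominus>\<^bsub>M\<^esub> b $ i) (\<lambda>i. T $$ (i, j)) = \<zero>\<^bsub>M\<^esub>" .
    qed (use that a_cl b_cl in auto)
    then have "a $ i = b $ i" if "i < k" for i
      using that a_cl[OF that] b_cl[OF that] M.minus_equality[of "a $ i" "\<ominus>\<^bsub>M\<^esub> (b $ i)"]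
      by (simp add: M.minus_eq)
    then show "a = b"
      using a b by (intro eq_vecI) (auto simp: vecs_over_def)
  next
    show "(\<lambda>a. mat_action M a T) ` vecs_over M k = vecs_over M k"
    proof
      show "(\<lambda>a. mat_action M a T) ` vecs_over M k \<subseteq> vecs_over M k" using closed by auto
      show "vecs_over M k \<subseteq> (\<lambda>a. mat_action M a T) ` vecs_over M k"
      proof
        fix t assume t: "t \<in> vecs_over M k"
        obtain a where a: "\<And>i. i \<in> {..<k} \<Longrightarrow> a i \<in> carrier M"
          "\<And>j. j \<in> {..<k} \<Longrightarrow> comb {..<k} a (\<lambda>i. T $$ (i, j)) = t $ j"
          using nonsing_solve[OF ns, of "\<lambda>j. t $ j"] t by (auto simp: vecs_over_def)
        have v: "vec k a \<in> vecs_over M k" using a by (auto simp: vecs_over_def)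
        have "comb {..<k} (\<lambda>i. vec k a $ i) (\<lambda>i. T $$ (i, j)) = t $ j" if "j < k" for j
        proof -
          have "comb {..<k} (\<lambda>i. vec k a $ i) (\<lambda>i. T $$ (i, j)) = comb {..<k} a (\<lambda>i. T $$ (i, j))"
            using a(1) cl that by (intro comb_cong) auto
          then show ?thesis using a(2) that by simp
        qed
        then have "mat_action M (vec k a) T = t"
          using t v dim by (intro eq_vecI) (auto simp: mat_action_def act vecs_over_def)
        then show "t \<in> (\<lambda>a. mat_action M a T) ` vecs_over M k" using v by auto
      qed
    qed
  qed
qed

text \<open>Condition $(E_{k+1})$ is applied to the first \<open>k\<close> columns as
  \<open>X\<close> and to the last column as \<open>y\<close>. If \<open>y\<close> annihilates the
  kernel, this is the first alternative; if it maps the kernel bijectively onto $M$, the old block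
  can be enlarged by the last row and column.\<close>

lemma kernel_dichotomy_lessThan:
  assumes E: "E_condition R M (Suc k)"
    and A: "\<And>p q. p < Suc k \<Longrightarrow> q < Suc k \<Longrightarrow> A p q \<in> carrier R"
    and ns: "nonsing {..<k} {..<k} A"
  shows "(\<forall>a. (\<forall>p<Suc k. a p \<in> carrier M) \<longrightarrow>
      (\<forall>q<k. comb {..<Suc k} a (\<lambda>p. A p q) = \<zero>\<^bsub>M\<^esub>) \<longrightarrow> comb {..<Suc k} a (\<lambda>p. A p k) = \<zero>\<^bsub>M\<^esub>) \<or>
    nonsing {..<Suc k} {..<Suc k} A"
proof -
  define X where "X = mat (Suc k) k (\<lambda>(p, q). A p q)"
  define y where "y = vec (Suc k) (\<lambda>p. A p k)"
  have X: "X \<in> mats_over R (Suc k) (Suc k - 1)" and y: "y \<in> vecs_over R (Suc k)"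
    using A by (auto simp: X_def y_def mats_over_def vecs_over_def)
  have "M_invertible M k (top_block k X)"
  proof (rule M_invertible_if_nonsing)
    show "top_block k X \<in> mats_over R k k"
      using A by (auto simp: X_def top_block_def mats_over_def)
    show "nonsing {..<k} {..<k} (\<lambda>i j. top_block k X $$ (i, j))"
      using A by (intro nonsing_cong[OF ns]) (auto simp: X_def top_block_def)
  qed
  then have "(\<forall>a \<in> ann_mat M X. vec_action M a y = \<zero>\<^bsub>M\<^esub>) \<or>
      bij_betw (\<lambda>a. vec_action M a y) (ann_mat M X) (carrier M)"
    using E X y unfolding E_condition_def by auto
  moreover have ann: "vec (Suc k) a \<in> ann_mat M X"
    if "\<And>p. p < Suc k \<Longrightarrow> a p \<in> carrier M" "\<And>q. q < k \<Longrightarrow> comb {..<Suc k} a (\<lambda>p. A p q) = \<zero>\<^bsub>M\<^esub>" for a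
  proof -
    have "vec_action M (vec (Suc k) a) (col X q) = \<zero>\<^bsub>M\<^esub>" if "q < k" for q
    proof -
      have "vec_action M (vec (Suc k) a) (col X q) = comb {..<Suc k} a (\<lambda>p. A p q)"
        using that A \<open>\<And>p. p < Suc k \<Longrightarrow> a p \<in> carrier M\<close>
        by (subst vec_action_eq_comb[of _ "Suc k"]) (auto simp: X_def intro!: comb_cong)
      then show ?thesis using \<open>\<And>q. q < k \<Longrightarrow> comb {..<Suc k} a (\<lambda>p. A p q) = \<zero>\<^bsub>M\<^esub>\<close> that by simp
    qed
    then show ?thesis
      using that(1) by (auto simp: ann_mat_def mat_action_def vecs_over_def X_def)
  qed
  moreover have act_y: "vec_action M (vec (Suc k) a) y = comb {..<Suc k} a (\<lambda>p. A p k)"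
    if "\<And>p. p < Suc k \<Longrightarrow> a p \<in> carrier M" for a
    using that A by (subst vec_action_eq_comb[of _ "Suc k"]) (auto simp: y_def intro!: comb_cong)
  moreover have ?thesis if bij: "bij_betw (\<lambda>a. vec_action M a y) (ann_mat M X) (carrier M)"
  proof -
    have "nonsing (insert k {..<k}) (insert k {..<k}) A"
    proof (rule nonsing_insert_if_kernel_bij[OF _ _ _ _ ns])
      fix m assume "m \<in> carrier M"
      then obtain v where v: "v \<in> ann_mat M X" "vec_action M v y = m"
        using bij by (metis bij_betwE bij_betw_imp_surj_on imageE)
      then have vd: "v \<in> carrier_vec (Suc k)" and v_cl: "\<And>p. p < Suc k \<Longrightarrow> v $ p \<in> carrier M"
        and v_eq: "mat_action M v X = vec k (\<lambda>_. \<zero>\<^bsub>M\<^esub>)"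
        by (auto simp: ann_mat_def vecs_over_def X_def)
      have "comb {..<Suc k} (\<lambda>p. v $ p) (\<lambda>p. A p q) = \<zero>\<^bsub>M\<^esub>" if "q < k" for q
      proof -
        have "vec_action M v (col X q) = comb {..<Suc k} (\<lambda>p. v $ p) (\<lambda>p. A p q)"
          using v_cl A that
          by (subst vec_action_eq_comb[of _ "Suc k"]) (auto simp: X_def intro!: comb_cong)
        then show ?thesis
          using arg_cong[OF v_eq, of "\<lambda>w. w $ q"] that by (simp add: mat_action_def X_def)
      qed
      moreover have "vec_action M v y = comb {..<Suc k} (\<lambda>p. v $ p) (\<lambda>p. A p k)"
        using v_cl A
        by (subst vec_action_eq_comb[of _ "Suc k"]) (auto simp: y_def intro!: comb_cong)
      ultimately show "\<exists>a. (\<forall>p\<in>insert k {..<k}. a p \<in> carrier M) \<and>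
        (\<forall>q\<in>{..<k}. comb (insert k {..<k}) a (\<lambda>p. A p q) = \<zero>\<^bsub>M\<^esub>) \<and>
        comb (insert k {..<k}) a (\<lambda>p. A p k) = m"
        using v(2) v_cl
        by (intro exI[of _ "\<lambda>p. v $ p"]) (auto simp: lessThan_Suc[symmetric])
    next
      fix a p assume a: "\<And>p. p \<in> insert k {..<k} \<Longrightarrow> a p \<in> carrier M"
        "\<And>q. q \<in> insert k {..<k} \<Longrightarrow> comb (insert k {..<k}) a (\<lambda>p. A p q) = \<zero>\<^bsub>M\<^esub>"
        and p: "p \<in> insert k {..<k}"
      have a_cl: "\<And>p. p < Suc k \<Longrightarrow> a p \<in> carrier M"
        using a(1) by (auto simp: less_Suc_eq)
      have a_eq: "\<And>q. q < Suc k \<Longrightarrow> comb {..<Suc k} a (\<lambda>p. A p q) = \<zero>\<^bsub>M\<^esub>"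
        using a(2) by (simp add: lessThan_Suc less_Suc_eq) blast
      have v: "vec (Suc k) a \<in> ann_mat M X" using ann a_cl a_eq by simp
      \<comment> \<open>The bijection is compared at the given vector and at zero: both lie in the
        annihilator of \<open>X\<close> and both are sent to zero by \<open>y\<close>, so they
        coincide.\<close>
      have z: "vec (Suc k) (\<lambda>_. \<zero>\<^bsub>M\<^esub>) \<in> ann_mat M X"
        using A by (intro ann) (auto intro!: comb_eq_zero)
      have "vec_action M (vec (Suc k) a) y = vec_action M (vec (Suc k) (\<lambda>_. \<zero>\<^bsub>M\<^esub>)) y"
        using A a_cl a_eq comb_eq_zero[of "{..<Suc k}" "\<lambda>_. \<zero>\<^bsub>M\<^esub>" "\<lambda>p. A p k"] by (simp add: act_y)
      then have "vec (Suc k) a = vec (Suc k) (\<lambda>_. \<zero>\<^bsub>M\<^esub>)"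
        using bij v z unfolding bij_betw_def inj_on_def by blast
      then have "vec (Suc k) a $ p = vec (Suc k) (\<lambda>_. \<zero>\<^bsub>M\<^esub>) $ p" by simp
      then show "a p = \<zero>\<^bsub>M\<^esub>" using p by auto
    qed (use A in auto)
    then show ?thesis by (simp add: lessThan_Suc)
  qed
  ultimately show ?thesis by metis
qed

text \<open>All later uses of condition $(E_n)$ go through this form. It follows from the numbered
  case by enumerating \<open>I\<close> and \<open>J\<close>, which have the same
  cardinality.\<close>

lemma kernel_dichotomy:
  assumes E: "E_condition R M (Suc (card I))"
    and fin: "finite I" "finite J" "card J = card I" "i \<notin> I" "j \<notin> J"
    and A: "\<And>p q. p \<in> insert i I \<Longrightarrow> q \<in> insert j J \<Longrightarrow> A p q \<in> carrier R"
    and ns: "nonsing I J A"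
  shows "(\<forall>a. (\<forall>p\<in>insert i I. a p \<in> carrier M) \<longrightarrow>
      (\<forall>q\<in>J. comb (insert i I) a (\<lambda>p. A p q) = \<zero>\<^bsub>M\<^esub>) \<longrightarrow>
      comb (insert i I) a (\<lambda>p. A p j) = \<zero>\<^bsub>M\<^esub>) \<or>
    nonsing (insert i I) (insert j J) A"
proof -
  define k where "k = card I"
  obtain h0 where h0: "bij_betw h0 {..<k} I"
    using ex_bij_betw_nat_finite[OF fin(1)] by (auto simp: k_def atLeast0LessThan)
  obtain g0 where g0: "bij_betw g0 {..<k} J"
    using ex_bij_betw_nat_finite[OF fin(2)] fin(3) by (auto simp: k_def atLeast0LessThan)
  \<comment> \<open>The new row and the new column both get the last index \<open>k\<close>, because
    $(E_n)$ assumes invertibility of the top block and treats \<open>y\<close> as the column added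
    to \<open>X\<close>.\<close>
  define h g where "h = h0(k := i)" and "g = g0(k := j)"
  have hI: "h ` {..<k} = I" "inj_on h {..<k}"
    using h0 by (auto simp: h_def bij_betw_def inj_on_def)
  have gJ: "g ` {..<k} = J" "inj_on g {..<k}"
    using g0 by (auto simp: g_def bij_betw_def inj_on_def)
  have hk: "h k = i" "g k = j" by (auto simp: h_def g_def)
  have hI': "h ` {..<Suc k} = insert i I" "inj_on h {..<Suc k}"
    using hI fin hk by (auto simp: lessThan_Suc)
  have gJ': "g ` {..<Suc k} = insert j J" "inj_on g {..<Suc k}"
    using gJ fin hk by (auto simp: lessThan_Suc)
  define A' where "A' = (\<lambda>p q. A (h p) (g q))"
  have A': "A' p q \<in> carrier R" if "p < Suc k" "q < Suc k" for p q
    using A that hI'(1) gJ'(1) unfolding A'_def by blast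
  have "nonsing {..<k} {..<k} A'"
    using ns nonsing_reindex[OF hI(2) gJ(2), of A] A' unfolding hI gJ A'_def by simp
  then have dich: "(\<forall>a. (\<forall>p<Suc k. a p \<in> carrier M) \<longrightarrow>
      (\<forall>q<k. comb {..<Suc k} a (\<lambda>p. A' p q) = \<zero>\<^bsub>M\<^esub>) \<longrightarrow> comb {..<Suc k} a (\<lambda>p. A' p k) = \<zero>\<^bsub>M\<^esub>) \<or>
    nonsing {..<Suc k} {..<Suc k} A'"
    using E A' by (intro kernel_dichotomy_lessThan) (auto simp: k_def)
  have re: "comb (insert i I) a (\<lambda>p. A p (g q)) = comb {..<Suc k} (\<lambda>p. a (h p)) (\<lambda>p. A' p q)"
    if "\<forall>p\<in>insert i I. a p \<in> carrier M" "q < Suc k" for a q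
  proof -
    have "a (h p) \<in> carrier M" if "p < Suc k" for p
      using \<open>\<forall>p\<in>insert i I. a p \<in> carrier M\<close> that hI'(1) by blast
    moreover have "A (h p) (g q) \<in> carrier R" if "p < Suc k" for p
      using A' that \<open>q < Suc k\<close> by (simp add: A'_def)
    ultimately show ?thesis
      unfolding hI'(1)[symmetric] A'_def using hI'(2) by (intro comb_reindex) auto
  qed
  from dich show ?thesis
  proof
    assume *: "\<forall>a. (\<forall>p<Suc k. a p \<in> carrier M) \<longrightarrow>
      (\<forall>q<k. comb {..<Suc k} a (\<lambda>p. A' p q) = \<zero>\<^bsub>M\<^esub>) \<longrightarrow> comb {..<Suc k} a (\<lambda>p. A' p k) = \<zero>\<^bsub>M\<^esub>"
    have "comb (insert i I) a (\<lambda>p. A p j) = \<zero>\<^bsub>M\<^esub>"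
      if a: "\<forall>p\<in>insert i I. a p \<in> carrier M" "\<forall>q\<in>J. comb (insert i I) a (\<lambda>p. A p q) = \<zero>\<^bsub>M\<^esub>" for a
    proof -
      have "\<forall>p<Suc k. a (h p) \<in> carrier M" using a(1) hI'(1) by blast
      moreover have "comb {..<Suc k} (\<lambda>p. a (h p)) (\<lambda>p. A' p q) = \<zero>\<^bsub>M\<^esub>" if "q < k" for q
        using re[OF a(1), of q] that a(2) gJ(1) by auto
      ultimately show ?thesis using * re[OF a(1), of k] hk by auto
    qed
    then show ?thesis by blast
  next
    assume "nonsing {..<Suc k} {..<Suc k} A'"
    then show ?thesis
      using nonsing_reindex[OF hI'(2) gJ'(2), of A] A' unfolding hI'(1) gJ'(1) A'_def by simp
  qed
qed

section \<open>Chains of annihilators\<close>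

text \<open>This is the inclusion of the annihilator of the columns \<open>J\<close> in that of
  column \<open>c\<close>, over the rows \<open>N\<close>. Thus adjoining \<open>c\<close> to
  \<open>J\<close> makes the annihilator strictly smaller exactly when \<open>kills\<close>
  fails.\<close>

definition kills :: "'i set \<Rightarrow> 'j set \<Rightarrow> ('i \<Rightarrow> 'j \<Rightarrow> 'a) \<Rightarrow> 'j \<Rightarrow> bool" where
  "kills N J W c \<longleftrightarrow> (\<forall>a. (\<forall>p\<in>N. a p \<in> carrier M) \<longrightarrow>
      (\<forall>q\<in>J. comb N a (\<lambda>p. W p q) = \<zero>\<^bsub>M\<^esub>) \<longrightarrow> comb N a (\<lambda>p. W p c) = \<zero>\<^bsub>M\<^esub>)"

lemma killsD:
  assumes "kills N J W c" "\<And>p. p \<in> N \<Longrightarrow> a p \<in> carrier M"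
    and "\<And>q. q \<in> J \<Longrightarrow> comb N a (\<lambda>p. W p q) = \<zero>\<^bsub>M\<^esub>"
  shows "comb N a (\<lambda>p. W p c) = \<zero>\<^bsub>M\<^esub>"
  using assms unfolding kills_def by blast

lemma kills_mono: "kills N J W c \<Longrightarrow> J \<subseteq> K \<Longrightarrow> kills N K W c"
  unfolding kills_def by blast

text \<open>An element of the annihilator is a sum of elements supported on \<open>I\<close> and one further
  row, because the entries on the rows outside \<open>I\<close> can be prescribed.\<close>

lemma kills_if_kills_rows:
  assumes fin: "finite I" "finite T" "I \<inter> T = {}"
    and W: "\<And>p q. p \<in> I \<union> T \<Longrightarrow> q \<in> insert c J \<Longrightarrow> W p q \<in> carrier R"
    and ns: "nonsing I J W"
    and rows: "\<And>i. i \<in> T \<Longrightarrow> kills (insert i I) J W c"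
  shows "kills (I \<union> T) J W c"
  using fin(2,3) W rows
proof (induction T rule: finite_induct)
  case empty
  show ?case unfolding kills_def
  proof (intro allI impI)
    fix a assume a: "\<forall>p\<in>I \<union> {}. a p \<in> carrier M" "\<forall>q\<in>J. comb (I \<union> {}) a (\<lambda>p. W p q) = \<zero>\<^bsub>M\<^esub>"
    have "a p = \<zero>\<^bsub>M\<^esub>" if "p \<in> I" for p
      by (rule nonsing_kernel[OF ns, of a]) (use a that in auto)
    then show "comb (I \<union> {}) a (\<lambda>p. W p c) = \<zero>\<^bsub>M\<^esub>"
      using empty by (intro comb_eq_zero) auto
  qed
next
  case (insert i T)
  have IH: "kills (I \<union> T) J W c" using insert.prems by (intro insert.IH) auto
  have i: "i \<notin> I" "i \<notin> T" using insert.hyps insert.prems by auto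
  have W: "\<And>p q. p \<in> insert i (I \<union> T) \<Longrightarrow> q \<in> insert c J \<Longrightarrow> W p q \<in> carrier R"
    using insert.prems by auto
  show ?case unfolding kills_def
  proof (intro allI impI)
    fix a assume a0: "\<forall>p\<in>I \<union> insert i T. a p \<in> carrier M"
      "\<forall>q\<in>J. comb (I \<union> insert i T) a (\<lambda>p. W p q) = \<zero>\<^bsub>M\<^esub>"
    have a: "\<And>p. p \<in> insert i (I \<union> T) \<Longrightarrow> a p \<in> carrier M"
      "\<And>q. q \<in> J \<Longrightarrow> comb (insert i (I \<union> T)) a (\<lambda>p. W p q) = \<zero>\<^bsub>M\<^esub>"
      using a0 by auto
    have "\<ominus>\<^bsub>M\<^esub> (a i \<star>\<^bsub>M\<^esub> W i q) \<in> carrier M" if "q \<in> J" for q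
      using a W that by auto
    then obtain x where x: "\<And>p. p \<in> I \<Longrightarrow> x p \<in> carrier M"
      "\<And>q. q \<in> J \<Longrightarrow> comb I x (\<lambda>p. W p q) = \<ominus>\<^bsub>M\<^esub> (a i \<star>\<^bsub>M\<^esub> W i q)"
      using nonsing_solve[OF ns, of "\<lambda>q. \<ominus>\<^bsub>M\<^esub> (a i \<star>\<^bsub>M\<^esub> W i q)"] by blast
    \<comment> \<open>\<open>e\<close> agrees with \<open>a\<close> in row \<open>i\<close>, and its
      entries on \<open>I\<close> cancel the contribution of that row in every column of
      \<open>J\<close>. It is therefore an annihilator element supported on \<open>I\<close> and the
      single further row \<open>i\<close>.\<close>
    define e where "e = (\<lambda>p. if p = i then a i else if p \<in> I then x p else \<zero>\<^bsub>M\<^esub>)"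
    have e_cl: "e p \<in> carrier M" for p using x a by (auto simp: e_def)
    have e_I: "comb (insert i I) e (\<lambda>p. W p q) = a i \<star>\<^bsub>M\<^esub> W i q \<oplus>\<^bsub>M\<^esub> comb I x (\<lambda>p. W p q)"
      if "q \<in> insert c J" for q
    proof -
      have "comb (insert i I) e (\<lambda>p. W p q) = e i \<star>\<^bsub>M\<^esub> W i q \<oplus>\<^bsub>M\<^esub> comb I e (\<lambda>p. W p q)"
        using fin i e_cl W that by (intro comb_insert) auto
      moreover have "comb I e (\<lambda>p. W p q) = comb I x (\<lambda>p. W p q)"
        using x W i that by (intro comb_cong) (auto simp: e_def)
      ultimately show ?thesis by (simp add: e_def)
    qed
    have e_N: "comb (insert i (I \<union> T)) e (\<lambda>p. W p q) = comb (insert i I) e (\<lambda>p. W p q)"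
      if "q \<in> insert c J" for q
      using fin insert.hyps e_cl W that by (intro comb_mono_neutral) (auto simp: e_def)
    have e_J: "comb (insert i I) e (\<lambda>p. W p q) = \<zero>\<^bsub>M\<^esub>" if "q \<in> J" for q
      using e_I[of q] x(2)[OF that] a W that by (auto simp: M.r_neg)
    have e_c: "comb (insert i I) e (\<lambda>p. W p c) = \<zero>\<^bsub>M\<^esub>"
      using e_cl e_J by (intro killsD[OF insert.prems(3)[of i]]) auto
    \<comment> \<open>Row \<open>i\<close> of \<open>b\<close> vanishes, so the induction hypothesis
      applies to it; and \<open>b\<close> has the same values as \<open>a\<close> in the columns of
      \<open>J\<close> and in column \<open>c\<close>.\<close>
    define b where "b = (\<lambda>p. a p \<ominus>\<^bsub>M\<^esub> e p)"
    have b_cl: "b p \<in> carrier M" if "p \<in> insert i (I \<union> T)" for p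
      using a e_cl that by (auto simp: b_def)
    have b_N: "comb (I \<union> T) b (\<lambda>p. W p q) = comb (insert i (I \<union> T)) a (\<lambda>p. W p q)"
      if "q \<in> insert c J" for q
    proof -
      have "comb (I \<union> T) b (\<lambda>p. W p q) = comb (insert i (I \<union> T)) b (\<lambda>p. W p q)"
        using fin insert.hyps b_cl W that i a
        by (intro comb_mono_neutral[symmetric]) (auto simp: b_def e_def M.minus_eq M.r_neg)
      also have "\<dots> = comb (insert i (I \<union> T)) a (\<lambda>p. W p q) \<ominus>\<^bsub>M\<^esub>
          comb (insert i (I \<union> T)) e (\<lambda>p. W p q)"
        unfolding b_def using a e_cl W that by (intro comb_diff_left) auto
      also have "comb (insert i (I \<union> T)) e (\<lambda>p. W p q) = \<zero>\<^bsub>M\<^esub>"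
        using e_N e_J e_c that by auto
      finally show ?thesis
        using comb_closed[of "insert i (I \<union> T)" a "\<lambda>p. W p q"] a W that
        by (simp add: M.minus_eq)
    qed
    have "comb (I \<union> T) b (\<lambda>p. W p c) = \<zero>\<^bsub>M\<^esub>"
      using b_cl b_N a by (intro killsD[OF IH]) auto
    then show "comb (I \<union> insert i T) a (\<lambda>p. W p c) = \<zero>\<^bsub>M\<^esub>"
      using b_N by auto
  qed
qed

text \<open>If \<open>c\<close> is not killed over all of \<open>N\<close>, then by
  \<open>kills_if_kills_rows\<close> it already fails to be killed over \<open>I\<close> and one
  further row. For that row the first alternative of \<open>kernel_dichotomy\<close> is excluded, so
  the block grows.\<close>

lemma nonsing_extend:
  assumes E: "\<And>n. 0 < n \<Longrightarrow> n \<le> card N \<Longrightarrow> E_condition R M n"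
    and fin: "finite N" "I \<subseteq> N" "finite J" "card J = card I"
    and W: "\<And>p q. p \<in> N \<Longrightarrow> q \<in> insert c J \<Longrightarrow> W p q \<in> carrier R"
    and ns: "nonsing I J W" and nk: "\<not> kills N J W c"
  obtains i where "i \<in> N - I" "c \<notin> J" "nonsing (insert i I) (insert c J) W"
proof -
  have finI: "finite I" using fin finite_subset by auto
  have c: "c \<notin> J" using nk unfolding kills_def by blast
  have N: "I \<union> (N - I) = N" using fin by auto
  have "\<exists>i\<in>N - I. \<not> kills (insert i I) J W c"
  proof (rule ccontr)
    assume "\<not> ?thesis"
    then have "kills (I \<union> (N - I)) J W c"
      using finI fin N W ns by (intro kills_if_kills_rows) auto
    then show False using nk N by simp
  qed
  then obtain i where i: "i \<in> N - I" "\<not> kills (insert i I) J W c" by blast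
  \<comment> \<open>The row \<open>i\<close> lies outside \<open>I\<close>, so the bordered block
    has size at most \<open>card N\<close>, which is within the range of the hypothesis
    \<open>E\<close>.\<close>
  have "card I < card N" using fin i by (intro psubset_card_mono) auto
  then have "E_condition R M (Suc (card I))" by (intro E) auto
  then have "kills (insert i I) J W c \<or> nonsing (insert i I) (insert c J) W"
    unfolding kills_def using fin finI i c W ns by (intro kernel_dichotomy) auto
  then show thesis using that i c by blast
qed

text \<open>The block is built greedily, as in the choice of a column basis: each column of
  \<open>L\<close> is either already killed by the chosen ones or enlarges the block.\<close>

lemma exists_spanning_nonsing:
  assumes E: "\<And>n. 0 < n \<Longrightarrow> n \<le> card N \<Longrightarrow> E_condition R M n"
    and fin: "finite N" "finite L"
    and W: "\<And>p q. p \<in> N \<Longrightarrow> q \<in> L \<Longrightarrow> W p q \<in> carrier R"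
  shows "\<exists>I J. I \<subseteq> N \<and> J \<subseteq> L \<and> card J = card I \<and> nonsing I J W \<and> (\<forall>c\<in>L. kills N J W c)"
  using fin(2) W
proof (induction L rule: finite_induct)
  case empty
  show ?case using nonsing_empty by (intro exI[of _ "{}"]) auto
next
  case (insert c L)
  then obtain I J where IJ: "I \<subseteq> N" "J \<subseteq> L" "card J = card I" "nonsing I J W" "\<forall>c\<in>L. kills N J W c"
    by (metis insertCI)
  have finJ: "finite J" using IJ insert finite_subset by auto
  have finI: "finite I" using IJ(1) fin(1) by (rule finite_subset)
  show ?case
  proof (cases "kills N J W c")
    case True
    then show ?thesis using IJ by (intro exI[of _ I] exI[of _ J]) auto
  next
    case False
    obtain i where i: "i \<in> N - I" "c \<notin> J" "nonsing (insert i I) (insert c J) W"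
      using nonsing_extend[OF E fin(1) IJ(1) finJ IJ(3) _ IJ(4) False] insert.prems IJ(2) by blast
    have "kills N (insert c J) W q" if "q \<in> insert c L" for q
      using IJ(5) that kills_mono[of N J W q "insert c J"] by (auto simp: kills_def)
    then show ?thesis
      using i IJ finI finJ by (intro exI[of _ "insert i I"] exI[of _ "insert c J"]) auto
  qed
qed

text \<open>Here \<open>L\<close> stands for the columns of $A$, and \<open>b\<close>,
  \<open>c\<close> for the columns added in $B$ and $C$. The hypotheses \<open>bL\<close> and
  \<open>cb\<close> are the two strict steps of the chain, and the conclusion denies the inclusion
  of $ann(C)$ in $ann(B)$. A block spanning \<open>L\<close> can be enlarged by \<open>b\<close> and
  then by \<open>c\<close>, after which values in these two columns can be prescribed
  independently.\<close>

lemma no_annihilator_chain: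
  assumes E: "\<And>n. 0 < n \<Longrightarrow> n \<le> card N \<Longrightarrow> E_condition R M n"
    and fin: "finite N" "finite L"
    and W: "\<And>p q. p \<in> N \<Longrightarrow> q \<in> insert b (insert c L) \<Longrightarrow> W p q \<in> carrier R"
    and bL: "\<not> kills N L W b" and cb: "\<not> kills N (insert b L) W c"
  shows "\<not> kills N (insert c L) W b"
proof
  assume bc: "kills N (insert c L) W b"
  obtain I J where IJ: "I \<subseteq> N" "J \<subseteq> L" "card J = card I" "nonsing I J W" "\<forall>c\<in>L. kills N J W c"
    using exists_spanning_nonsing[OF E fin, of W] W by blast
  have finJ: "finite J" using IJ(2) fin(2) by (rule finite_subset)
  have finI: "finite I" using IJ(1) fin(1) by (rule finite_subset)
  have "\<not> kills N J W b" using bL kills_mono[OF _ IJ(2), of N W b] by auto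
  then obtain i where i: "i \<in> N - I" "b \<notin> J" "nonsing (insert i I) (insert b J) W"
    using nonsing_extend[OF E fin(1) IJ(1) finJ IJ(3) _ IJ(4), of b] W IJ(2) by blast
  have "\<not> kills N (insert b J) W c"
    using cb kills_mono[OF _ insert_mono[OF IJ(2)], of N b W c] by auto
  moreover have "insert i I \<subseteq> N" "finite (insert b J)" "card (insert b J) = card (insert i I)"
    using i IJ finI finJ by auto
  moreover have "W p q \<in> carrier R" if "p \<in> N" "q \<in> insert c (insert b J)" for p q
    using W[of p q] that IJ(2) by blast
  ultimately obtain i' where i': "i' \<in> N - insert i I" "c \<notin> insert b J"
    "nonsing (insert i' (insert i I)) (insert c (insert b J)) W"
    using nonsing_extend[OF E fin(1) _ _ _ _ i(3), of c] by blast
  define I' where "I' = insert i' (insert i I)"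
  have I': "I' \<subseteq> N" "finite I'" using i i' IJ finI by (auto simp: I'_def)
  \<comment> \<open>\<open>a0\<close> provides a nonzero element \<open>m\<close> of $M$. This
    \<open>m\<close> is prescribed in column \<open>b\<close>, and zero in \<open>c\<close> and in
    the columns of \<open>J\<close>.\<close>
  obtain a0 where a0: "\<And>p. p \<in> N \<Longrightarrow> a0 p \<in> carrier M" "comb N a0 (\<lambda>p. W p b) \<noteq> \<zero>\<^bsub>M\<^esub>"
    using bL unfolding kills_def by blast
  define m where "m = comb N a0 (\<lambda>p. W p b)"
  have m: "m \<in> carrier M" unfolding m_def using a0 W by (intro comb_closed) auto
  have t: "(\<lambda>q. if q = b then m else \<zero>\<^bsub>M\<^esub>) \<in> insert c (insert b J) \<rightarrow> carrier M"
    using m by simp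
  have "\<exists>x\<in>I' \<rightarrow> carrier M. \<forall>q\<in>insert c (insert b J).
      comb I' x (\<lambda>p. W p q) = (if q = b then m else \<zero>\<^bsub>M\<^esub>)"
    unfolding I'_def by (rule bspec[OF conjunct1[OF i'(3)[unfolded nonsing_def]] t])
  then obtain x where x: "\<And>p. p \<in> I' \<Longrightarrow> x p \<in> carrier M"
    "\<And>q. q \<in> insert c (insert b J) \<Longrightarrow> comb I' x (\<lambda>p. W p q) = (if q = b then m else \<zero>\<^bsub>M\<^esub>)"
    by (metis Pi_mem)
  define a where "a = (\<lambda>p. if p \<in> I' then x p else \<zero>\<^bsub>M\<^esub>)"
  have a_cl: "a p \<in> carrier M" for p using x by (auto simp: a_def)
  have a_N: "comb N a (\<lambda>p. W p q) = (if q = b then m else \<zero>\<^bsub>M\<^esub>)" if "q \<in> insert c (insert b J)" for q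
  proof -
    have Wq: "W p q \<in> carrier R" if "p \<in> N" for p
      using W[of p q] that \<open>q \<in> _\<close> IJ(2) by blast
    have "comb N a (\<lambda>p. W p q) = comb I' a (\<lambda>p. W p q)"
      using fin I' a_cl Wq by (intro comb_mono_neutral) (auto simp: a_def)
    also have "\<dots> = comb I' x (\<lambda>p. W p q)"
      using I' x Wq by (intro comb_cong) (auto simp: a_def)
    finally show ?thesis using x(2)[OF that] by simp
  qed
  \<comment> \<open>Column \<open>c\<close> gives zero by the choice of \<open>x\<close>. A column
    of \<open>L\<close> need not belong to \<open>J\<close>, but it is killed by
    \<open>J\<close>.\<close>
  have "comb N a (\<lambda>p. W p q) = \<zero>\<^bsub>M\<^esub>" if "q \<in> insert c L" for q
  proof (cases "q = c")
    case True
    then show ?thesis using a_N[of c] i'(2) by auto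
  next
    case False
    then have "kills N J W q" using IJ(5) that by auto
    then show ?thesis
    proof (rule killsD)
      fix q assume "q \<in> J"
      then show "comb N a (\<lambda>p. W p q) = \<zero>\<^bsub>M\<^esub>" using a_N[of q] i(2) by auto
    qed (rule a_cl)
  qed
  then have "comb N a (\<lambda>p. W p b) = \<zero>\<^bsub>M\<^esub>"
    using a_cl by (intro killsD[OF bc]) auto
  then show False using a_N[of b] a0(2) by (simp add: m_def)
qed

section \<open>Annihilators of matrices and added columns\<close>

lemma mem_ann_mat_iff:
  assumes "A \<in> mats_over R n m"
  shows "v \<in> ann_mat M A \<longleftrightarrow> v \<in> vecs_over M n \<and>
    (\<forall>j<m. comb {..<n} (\<lambda>i. v $ i) (\<lambda>i. A $$ (i, j)) = \<zero>\<^bsub>M\<^esub>)"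
proof -
  have dim: "dim_row A = n" "dim_col A = m"
    and cl: "\<And>i j. i < n \<Longrightarrow> j < m \<Longrightarrow> A $$ (i, j) \<in> carrier R"
    using assms by (auto simp: mats_over_def)
  have act: "vec_action M v (col A j) = comb {..<n} (\<lambda>i. v $ i) (\<lambda>i. A $$ (i, j))"
    if "v \<in> vecs_over M n" "j < m" for j
    unfolding vec_action_eq_comb[of "col A j" n, OF trans[OF dim_col dim(1)]]
    using that dim cl by (intro comb_cong) (auto simp: vecs_over_def)
  have "mat_action M v A = vec m (\<lambda>_. \<zero>\<^bsub>M\<^esub>) \<longleftrightarrow> (\<forall>j<m. vec_action M v (col A j) = \<zero>\<^bsub>M\<^esub>)"
    unfolding mat_action_def dim by (auto simp: vec_eq_iff)
  then show ?thesis
    using act dim by (auto simp: ann_mat_def)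
qed

text \<open>An annihilator does not depend on the order of the columns, so wherever the column is
  inserted, it contributes just one further equation.\<close>

lemma mem_ann_mat_adds_column:
  assumes A: "A \<in> mats_over R n m" and B: "B \<in> mats_over R n (Suc m)" and add: "adds_column A B"
  obtains k where "k < Suc m" "\<And>v. v \<in> ann_mat M B \<longleftrightarrow>
    v \<in> ann_mat M A \<and> comb {..<n} (\<lambda>i. v $ i) (\<lambda>i. B $$ (i, k)) = \<zero>\<^bsub>M\<^esub>"
proof -
  have dim: "dim_row A = n" "dim_col A = m" "dim_row B = n" "dim_col B = Suc m"
    using A B by (auto simp: mats_over_def)
  then obtain k where k: "k < Suc m" "A = mat n m (\<lambda>(i, j). B $$ (i, if j < k then j else Suc j))"
    using add unfolding adds_column_def by auto
  \<comment> \<open>\<open>s\<close> lists the columns of \<open>B\<close> other than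
    \<open>k\<close> in increasing order; together with \<open>k\<close> its values on the numbers
    below \<open>m\<close> exhaust the columns of \<open>B\<close>.\<close>
  define s where "s = (\<lambda>j. if j < k then j else Suc j)"
  have "B $$ (i, s j) \<in> carrier R" if "i < n" "j < m" for i j
    using B that by (auto simp: mats_over_def s_def)
  moreover have "A $$ (i, j) = B $$ (i, s j)" if "i < n" "j < m" for i j
    using k(2) that by (simp add: s_def)
  ultimately have col: "comb {..<n} (\<lambda>i. v $ i) (\<lambda>i. A $$ (i, j)) = comb {..<n} (\<lambda>i. v $ i) (\<lambda>i. B $$ (i, s j))"
    if "v \<in> vecs_over M n" "j < m" for v j
    using that by (intro comb_cong) (auto simp: vecs_over_def)
  have split: "(\<forall>j<Suc m. P j) \<longleftrightarrow> (\<forall>j<m. P (s j)) \<and> P k" for P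
  proof
    assume R: "(\<forall>j<m. P (s j)) \<and> P k"
    show "\<forall>j<Suc m. P j"
    proof (intro allI impI)
      fix j assume j: "j < Suc m"
      consider "j < k" | "j = k" | "k < j" by linarith
      then show "P j"
      proof cases
        case 1
        then have "P (s j)" using R k(1) by auto
        then show ?thesis using 1 by (simp add: s_def)
      next
        case 3
        then have "P (s (j - 1))" using R j by auto
        then show ?thesis using 3 by (auto simp: s_def split: if_splits)
      qed (use R in simp)
    qed
  qed (use k(1) in \<open>auto simp: s_def\<close>)
  have "v \<in> ann_mat M B \<longleftrightarrow>
    v \<in> ann_mat M A \<and> comb {..<n} (\<lambda>i. v $ i) (\<lambda>i. B $$ (i, k)) = \<zero>\<^bsub>M\<^esub>" for v
    unfolding mem_ann_mat_iff[OF A] mem_ann_mat_iff[OF B] split using col by auto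
  then show thesis using that k(1) by blast
qed

lemma no_matrix_annihilator_chain:
  assumes E: "\<And>k. 0 < k \<Longrightarrow> k \<le> n \<Longrightarrow> E_condition R M k"
    and A: "A \<in> mats_over R n (n - 1)" and B: "B \<in> mats_over R n n" and C: "C \<in> mats_over R n n"
    and add: "adds_column A B" "adds_column A C"
  shows "\<not> (ann_mat M C \<subset> ann_mat M B \<and> ann_mat M B \<subset> ann_mat M A)"
proof
  assume chain: "ann_mat M C \<subset> ann_mat M B \<and> ann_mat M B \<subset> ann_mat M A"
  \<comment> \<open>This excludes $n = 0$: natural subtraction would give \<open>A\<close> zero
    columns, and \<open>B\<close> would then need one column instead of zero.\<close>
  have "n = Suc (n - 1)"
    using add(1) A B by (auto simp: adds_column_def mats_over_def)
  then obtain m where n: "n = Suc m" by blast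
  have A': "A \<in> mats_over R n m" and B': "B \<in> mats_over R n (Suc m)" and C': "C \<in> mats_over R n (Suc m)"
    using A B C n by auto
  obtain kb where kb: "kb < Suc m" "\<And>v. v \<in> ann_mat M B \<longleftrightarrow>
    v \<in> ann_mat M A \<and> comb {..<n} (\<lambda>i. v $ i) (\<lambda>i. B $$ (i, kb)) = \<zero>\<^bsub>M\<^esub>"
    using mem_ann_mat_adds_column[OF A' B' add(1)] by blast
  obtain kc where kc: "kc < Suc m" "\<And>v. v \<in> ann_mat M C \<longleftrightarrow>
    v \<in> ann_mat M A \<and> comb {..<n} (\<lambda>i. v $ i) (\<lambda>i. C $$ (i, kc)) = \<zero>\<^bsub>M\<^esub>"
    using mem_ann_mat_adds_column[OF A' C' add(2)] by blast
  \<comment> \<open>The columns of \<open>A\<close> come first, the column added in \<open>B\<close>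
    has index \<open>m\<close>, and the column added in \<open>C\<close> has index
    \<open>Suc m\<close>. All three annihilators become conditions on columns of this one
    array.\<close>
  define W where "W = (\<lambda>i j. if j < m then A $$ (i, j) else if j = m then B $$ (i, kb) else C $$ (i, kc))"
  have W: "W p q \<in> carrier R" if "p < n" for p q
    using A' B' C' kb(1) kc(1) that by (auto simp: W_def mats_over_def)
  have annA: "v \<in> ann_mat M A \<longleftrightarrow> v \<in> vecs_over M n \<and>
    (\<forall>j\<in>{..<m}. comb {..<n} (\<lambda>i. v $ i) (\<lambda>i. W i j) = \<zero>\<^bsub>M\<^esub>)" for v
    unfolding mem_ann_mat_iff[OF A'] by (auto simp: W_def)
  have annB: "v \<in> ann_mat M B \<longleftrightarrow> v \<in> vecs_over M n \<and>
    (\<forall>j\<in>insert m {..<m}. comb {..<n} (\<lambda>i. v $ i) (\<lambda>i. W i j) = \<zero>\<^bsub>M\<^esub>)" for v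
    unfolding kb(2) annA by (auto simp: W_def)
  have annC: "v \<in> ann_mat M C \<longleftrightarrow> v \<in> vecs_over M n \<and>
    (\<forall>j\<in>insert (Suc m) {..<m}. comb {..<n} (\<lambda>i. v $ i) (\<lambda>i. W i j) = \<zero>\<^bsub>M\<^esub>)" for v
    unfolding kc(2) annA by (auto simp: W_def)
  have "\<not> kills {..<n} {..<m} W m"
  proof -
    obtain v where "v \<in> ann_mat M A" "v \<notin> ann_mat M B" using chain by blast
    then have v: "v \<in> vecs_over M n" "\<And>q. q \<in> {..<m} \<Longrightarrow> comb {..<n} (\<lambda>i. v $ i) (\<lambda>p. W p q) = \<zero>\<^bsub>M\<^esub>"
      "comb {..<n} (\<lambda>i. v $ i) (\<lambda>p. W p m) \<noteq> \<zero>\<^bsub>M\<^esub>"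
      unfolding annA annB by blast+
    then show ?thesis
      using killsD[of "{..<n}" "{..<m}" W "m" "\<lambda>i. v $ i"] by (auto simp: vecs_over_def)
  qed
  moreover have "\<not> kills {..<n} (insert m {..<m}) W (Suc m)"
  proof -
    obtain v where "v \<in> ann_mat M B" "v \<notin> ann_mat M C" using chain by blast
    then have v: "v \<in> vecs_over M n" "\<And>q. q \<in> (insert m {..<m}) \<Longrightarrow> comb {..<n} (\<lambda>i. v $ i) (\<lambda>p. W p q) = \<zero>\<^bsub>M\<^esub>"
      "comb {..<n} (\<lambda>i. v $ i) (\<lambda>p. W p (Suc m)) \<noteq> \<zero>\<^bsub>M\<^esub>"
      unfolding annB annC by blast+
    then show ?thesis
      using killsD[of "{..<n}" "(insert m {..<m})" W "(Suc m)" "\<lambda>i. v $ i"] by (auto simp: vecs_over_def)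
  qed
  moreover have "kills {..<n} (insert (Suc m) {..<m}) W m"
    unfolding kills_def
  proof (intro allI impI)
    fix a assume a: "\<forall>p\<in>{..<n}. a p \<in> carrier M"
      "\<forall>q\<in>insert (Suc m) {..<m}. comb {..<n} a (\<lambda>p. W p q) = \<zero>\<^bsub>M\<^esub>"
    have eq: "comb {..<n} (\<lambda>i. vec n a $ i) (\<lambda>p. W p q) = comb {..<n} a (\<lambda>p. W p q)" for q
      using a W by (intro comb_cong) auto
    have "vec n a \<in> vecs_over M n" using a by (auto simp: vecs_over_def)
    then have "vec n a \<in> ann_mat M C" unfolding annC eq using a by blast
    then have "vec n a \<in> ann_mat M B" using chain by blast
    then show "comb {..<n} a (\<lambda>p. W p m) = \<zero>\<^bsub>M\<^esub>" unfolding annB eq by blast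
  qed
  ultimately show False
    using no_annihilator_chain[of "{..<n}" "{..<m}" m "Suc m" W] E W by auto
qed

section \<open>The rational closure in the endomorphism ring\<close>

text \<open>Here \<open>A\<close> is the whole bordered matrix: \<open>z\<close> indexes the extra row \<open>u\<close> and the extra column
  \<open>v\<close>, and a solution \<open>a\<close> is an element of the kernel with last coordinate \<open>a z\<close>.\<close>

definition solution :: "'i \<Rightarrow> 'i set \<Rightarrow> ('i \<Rightarrow> 'i \<Rightarrow> 'a) \<Rightarrow> ('i \<Rightarrow> 'c) \<Rightarrow> bool" where
  "solution z I A a \<longleftrightarrow> (\<forall>p\<in>insert z I. a p \<in> carrier M) \<and>
    (\<forall>q\<in>I. comb (insert z I) a (\<lambda>p. A p q) = \<zero>\<^bsub>M\<^esub>)"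

text \<open>This expresses $d = r - u A^{-1} v$ without an inverse, as a relation between the input
  \<open>a z\<close> of a solution and its output in column \<open>z\<close>. Every element of $M$
  is the input of a solution, so \<open>d\<close> is determined on $M$; its values elsewhere are
  left free.\<close>

definition represents :: "'i \<Rightarrow> 'i set \<Rightarrow> ('i \<Rightarrow> 'i \<Rightarrow> 'a) \<Rightarrow> ('c \<Rightarrow> 'c) \<Rightarrow> bool" where
  "represents z I A d \<longleftrightarrow> finite I \<and> z \<notin> I \<and>
    (\<forall>p\<in>insert z I. \<forall>q\<in>insert z I. A p q \<in> carrier R) \<and> nonsing I I A \<and>
    (\<forall>a. solution z I A a \<longrightarrow> comb (insert z I) a (\<lambda>p. A p z) = d (a z))"

text \<open>The contribution of the prescribed entry \<open>x\<close> in row \<open>w\<close> is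
  moved to the right-hand side, and the invertible block solves the resulting system.\<close>

lemma nonsing_solve_insert:
  assumes fin: "finite I" "w \<notin> I"
    and A: "\<And>p q. p \<in> insert w I \<Longrightarrow> q \<in> J \<Longrightarrow> A p q \<in> carrier R"
    and ns: "nonsing I J A" and x: "x \<in> carrier M" and t: "\<And>q. q \<in> J \<Longrightarrow> t q \<in> carrier M"
  obtains a where "a w = x" "\<And>p. p \<in> insert w I \<Longrightarrow> a p \<in> carrier M"
    "\<And>q. q \<in> J \<Longrightarrow> comb (insert w I) a (\<lambda>p. A p q) = t q"
proof -
  define s where "s = (\<lambda>q. t q \<ominus>\<^bsub>M\<^esub> x \<star>\<^bsub>M\<^esub> A w q)"
  have "s q \<in> carrier M" if "q \<in> J" for q
    using A x t that by (auto simp: s_def)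
  then obtain b where b: "\<And>p. p \<in> I \<Longrightarrow> b p \<in> carrier M" "\<And>q. q \<in> J \<Longrightarrow> comb I b (\<lambda>p. A p q) = s q"
    using nonsing_solve[OF ns, of s] by blast
  define a where "a = b(w := x)"
  have a_cl: "a p \<in> carrier M" if "p \<in> insert w I" for p
    using b x that by (auto simp: a_def)
  have "comb (insert w I) a (\<lambda>p. A p q) = t q" if q: "q \<in> J" for q
  proof -
    have "comb (insert w I) a (\<lambda>p. A p q) = a w \<star>\<^bsub>M\<^esub> A w q \<oplus>\<^bsub>M\<^esub> comb I a (\<lambda>p. A p q)"
      using fin a_cl A q by (intro comb_insert) auto
    also have "comb I a (\<lambda>p. A p q) = comb I b (\<lambda>p. A p q)"
      using fin b A q by (intro comb_cong) (auto simp: a_def)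
    also have "\<dots> = t q \<ominus>\<^bsub>M\<^esub> x \<star>\<^bsub>M\<^esub> A w q"
      using b q by (simp add: s_def)
    also have "a w \<star>\<^bsub>M\<^esub> A w q \<oplus>\<^bsub>M\<^esub> (t q \<ominus>\<^bsub>M\<^esub> x \<star>\<^bsub>M\<^esub> A w q) = t q"
      using x t q A[of w q] by (simp add: a_def M.minus_eq M.a_lcomm[of _ "t q"] M.r_neg)
    finally show ?thesis .
  qed
  moreover have "a w = x" by (simp add: a_def)
  ultimately show thesis using that a_cl by blast
qed

lemma solution_exists:
  assumes "finite I" "z \<notin> I" "\<And>p q. p \<in> insert z I \<Longrightarrow> q \<in> I \<Longrightarrow> A p q \<in> carrier R"
    and "nonsing I I A" "m \<in> carrier M"
  obtains a where "solution z I A a" "a z = m"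
proof -
  obtain a where "a z = m" "\<And>p. p \<in> insert z I \<Longrightarrow> a p \<in> carrier M"
    "\<And>q. q \<in> I \<Longrightarrow> comb (insert z I) a (\<lambda>p. A p q) = \<zero>\<^bsub>M\<^esub>"
    using nonsing_solve_insert[OF assms(1,2,3,4,5), of "\<lambda>_. \<zero>\<^bsub>M\<^esub>"] by blast
  then show thesis using that unfolding solution_def by blast
qed

lemma representsD:
  assumes "represents z I A d"
  shows "finite I" "z \<notin> I" "\<And>p q. p \<in> insert z I \<Longrightarrow> q \<in> insert z I \<Longrightarrow> A p q \<in> carrier R"
    "nonsing I I A" "\<And>a. solution z I A a \<Longrightarrow> comb (insert z I) a (\<lambda>p. A p z) = d (a z)"
  using assms unfolding represents_def by auto

lemma represents_solution:
  assumes "represents z I A d" "m \<in> carrier M"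
  obtains a where "solution z I A a" "a z = m" "comb (insert z I) a (\<lambda>p. A p z) = d m"
proof -
  note r = representsD[OF assms(1)]
  obtain a where "solution z I A a" "a z = m"
    using solution_exists[OF r(1,2) _ r(4) assms(2)] r(3) by blast
  then show thesis using that r(5) by blast
qed

lemma solution_closed: "solution z I A a \<Longrightarrow> p \<in> insert z I \<Longrightarrow> a p \<in> carrier M"
  unfolding solution_def by blast

lemma represents_closed:
  assumes "represents z I A d" "m \<in> carrier M"
  shows "d m \<in> carrier M"
proof -
  obtain a where a: "solution z I A a" "comb (insert z I) a (\<lambda>p. A p z) = d m"
    using represents_solution[OF assms] by blast
  have "comb (insert z I) a (\<lambda>p. A p z) \<in> carrier M"
    using solution_closed[OF a(1)] representsD(3)[OF assms(1)] by (intro comb_closed) auto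
  then show ?thesis using a(2) by simp
qed

text \<open>Solutions can be added, and both the input and the output of a solution are additive in
  it.\<close>

lemma represents_add:
  assumes "represents z I A d" "m \<in> carrier M" "m' \<in> carrier M"
  shows "d (m \<oplus>\<^bsub>M\<^esub> m') = d m \<oplus>\<^bsub>M\<^esub> d m'"
proof -
  note r = representsD[OF assms(1)]
  obtain a where a: "solution z I A a" "a z = m" "comb (insert z I) a (\<lambda>p. A p z) = d m"
    using represents_solution[OF assms(1,2)] by blast
  obtain b where b: "solution z I A b" "b z = m'" "comb (insert z I) b (\<lambda>p. A p z) = d m'"
    using represents_solution[OF assms(1,3)] by blast
  have add: "comb (insert z I) (\<lambda>p. a p \<oplus>\<^bsub>M\<^esub> b p) (\<lambda>p. A p q) =
      comb (insert z I) a (\<lambda>p. A p q) \<oplus>\<^bsub>M\<^esub> comb (insert z I) b (\<lambda>p. A p q)" if "q \<in> insert z I" for q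
    using solution_closed[OF a(1)] solution_closed[OF b(1)] r(3) that by (intro comb_add_left) auto
  have "solution z I A (\<lambda>p. a p \<oplus>\<^bsub>M\<^esub> b p)"
    using a(1) b(1) add unfolding solution_def by auto
  then have "comb (insert z I) (\<lambda>p. a p \<oplus>\<^bsub>M\<^esub> b p) (\<lambda>p. A p z) = d (m \<oplus>\<^bsub>M\<^esub> m')"
    using r(5)[of "\<lambda>p. a p \<oplus>\<^bsub>M\<^esub> b p"] a(2) b(2) by simp
  then show ?thesis using add[of z] a(3) b(3) by simp
qed

lemma represents_cong:
  assumes "represents z I A d" "\<And>m. m \<in> carrier M \<Longrightarrow> d' m = d m"
  shows "represents z I A d'"
proof -
  have "d' (a z) = d (a z)" if "solution z I A a" for a
    using assms(2) solution_closed[OF that] by blast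
  then show ?thesis using assms(1) unfolding represents_def by simp
qed

text \<open>A solution for \<open>A\<close> is also one for \<open>B\<close>, with the same output.
  This is what later permits coding a map by a matrix that represents it.\<close>

lemma represents_unique:
  assumes "represents z I A d" "represents z I B e" "m \<in> carrier M"
    and eq: "\<And>p q. p \<in> insert z I \<Longrightarrow> q \<in> insert z I \<Longrightarrow> A p q = B p q"
  shows "d m = e m"
proof -
  obtain a where a: "solution z I A a" "a z = m" "comb (insert z I) a (\<lambda>p. A p z) = d m"
    using represents_solution[OF assms(1,3)] by blast
  have c: "comb (insert z I) a (\<lambda>p. A p q) = comb (insert z I) a (\<lambda>p. B p q)" if "q \<in> insert z I" for q
    using eq that solution_closed[OF a(1)] representsD(3)[OF assms(2)] by (intro comb_cong) auto
  have "solution z I B a" using a(1) c unfolding solution_def by auto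
  then show ?thesis using representsD(5)[OF assms(2)] a c[of z] by auto
qed

lemma represents_reindex:
  assumes inj: "inj_on h (insert z I)" and rep: "represents (h z) (h ` I) A d"
  shows "represents z I (\<lambda>p q. A (h p) (h q)) d"
proof -
  note r = representsD[OF rep]
  have injI: "inj_on h I" using inj inj_on_subset by blast
  have A: "A (h p) (h q) \<in> carrier R" if "p \<in> insert z I" "q \<in> insert z I" for p q
    using r(3) that by auto
  have z: "z \<notin> I" using r(2) by auto
  have out: "comb (insert z I) a (\<lambda>p. A (h p) (h z)) = d (a z)"
    if a: "solution z I (\<lambda>p q. A (h p) (h q)) a" for a
  proof -
    define a' where "a' = (\<lambda>p. a (inv_into (insert z I) h p))"
    have a'h: "a' (h p) = a p" if "p \<in> insert z I" for p
      using inj that by (simp add: a'_def)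
    have eq: "comb (insert (h z) (h ` I)) a' (\<lambda>p. A p (h q)) = comb (insert z I) a (\<lambda>p. A (h p) (h q))"
      if "q \<in> insert z I" for q
    proof -
      have "comb (h ` insert z I) a' (\<lambda>p. A p (h q)) =
        comb (insert z I) (\<lambda>p. a' (h p)) (\<lambda>p. A (h p) (h q))"
        using inj a'h solution_closed[OF a] A that by (intro comb_reindex) auto
      also have "\<dots> = comb (insert z I) a (\<lambda>p. A (h p) (h q))"
        using a'h solution_closed[OF a] A that by (intro comb_cong) auto
      finally show ?thesis by simp
    qed
    have "solution (h z) (h ` I) A a'"
      using a a'h eq unfolding solution_def by auto
    then have "comb (insert (h z) (h ` I)) a' (\<lambda>p. A p (h z)) = d (a' (h z))" by (rule r(5))
    then show ?thesis using eq[of z] a'h[of z] by simp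
  qed
  have "nonsing I I (\<lambda>p q. A (h p) (h q))"
    using r(4) nonsing_reindex[OF injI injI, of A] A by blast
  then show ?thesis
    using r(1) A z out finite_imageD[OF _ injI] unfolding represents_def by auto
qed

text \<open>Sums, composites and inverses produce matrices over new index types. Returning to
  natural numbers lets the rational closure be defined over one fixed index type.\<close>

lemma represents_lessThan:
  assumes "represents z I A d"
  obtains n and A' :: "nat \<Rightarrow> nat \<Rightarrow> 'a" where "represents n {..<n} A' d"
proof -
  note r = representsD[OF assms]
  define n where "n = card I"
  obtain h0 where h0: "bij_betw h0 {..<n} I"
    using ex_bij_betw_nat_finite[OF r(1)] by (auto simp: n_def atLeast0LessThan)
  define h where "h = h0(n := z)"
  have h: "h ` {..<n} = I" "inj_on h {..<n}" "h n = z"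
    using h0 by (auto simp: h_def bij_betw_def inj_on_def)
  have "inj_on h (insert n {..<n})"
    using h r(2) by auto
  moreover have "represents (h n) (h ` {..<n}) A d"
    using assms h by simp
  ultimately have "represents n {..<n} (\<lambda>p q. A (h p) (h q)) d"
    by (rule represents_reindex)
  then show thesis by (rule that)
qed

text \<open>Feeds the auxiliary output \<open>f\<close> of the system \<open>A\<close> into the system \<open>B\<close>: the input of \<open>B\<close>
  becomes an unknown, tied to \<open>f\<close> by one more equation.\<close>

lemma represents_compose:
  fixes z :: 'i and w :: 'j
  assumes fin: "finite I" "z \<notin> I"
    and A: "\<And>p q. p \<in> insert z I \<Longrightarrow> q \<in> I \<Longrightarrow> A p q \<in> carrier R"
    and ns: "nonsing I I A"
    and u: "\<And>p. p \<in> insert z I \<Longrightarrow> u p \<in> carrier R"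
    and v: "\<And>p. p \<in> insert z I \<Longrightarrow> v p \<in> carrier R"
    and f: "\<And>a. solution z I A a \<Longrightarrow> comb (insert z I) a u = f (a z)"
    and g: "\<And>a. solution z I A a \<Longrightarrow> comb (insert z I) a v = g (a z)"
    and rep: "represents w J B e"
  shows "\<exists>C. represents (Inl z) (I <+> insert w J) C (\<lambda>m. g m \<oplus>\<^bsub>M\<^esub> e (f m))"
proof -
  note r = representsD[OF rep]
  \<comment> \<open>The columns \<open>Inl q\<close> with \<open>q\<close> in \<open>I\<close> carry
    the equations of \<open>A\<close>, and the columns \<open>Inr q\<close> with \<open>q\<close> in
    \<open>J\<close> those of \<open>B\<close>. Column \<open>Inr w\<close> consists of
    \<open>u\<close> and of $-1$ in row \<open>Inr w\<close>, so that it equates the input of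
    \<open>B\<close> with the auxiliary output \<open>f\<close>. The output column
    \<open>Inl z\<close> consists of \<open>v\<close> and of the output column \<open>w\<close> of
    \<open>B\<close>.\<close>
  define C where "C = case_sum
    (\<lambda>p. case_sum (\<lambda>q. if q = z then v p else A p q) (\<lambda>q. if q = w then u p else \<zero>\<^bsub>R\<^esub>))
    (\<lambda>p. case_sum (\<lambda>q. if q = z then B p w else \<zero>\<^bsub>R\<^esub>)
      (\<lambda>q. if q = w then (if p = w then \<ominus>\<^bsub>R\<^esub> \<one>\<^bsub>R\<^esub> else \<zero>\<^bsub>R\<^esub>) else B p q))"
  let ?L = "insert w J"
  have C_cl: "C p q \<in> carrier R" if "p \<in> insert z I <+> ?L" "q \<in> insert z I <+> ?L" for p q
    using that A u v r(3) by (auto simp: C_def)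
  have zw: "\<And>q. q \<in> I \<Longrightarrow> q \<noteq> z" "\<And>q. q \<in> J \<Longrightarrow> q \<noteq> w" using fin r(2) by auto
  \<comment> \<open>\<open>K\<close> will be \<open>I\<close> when the block itself is shown to be
    invertible, and \<open>insert z I\<close> when the input row is present as well.\<close>
  have split: "comb (K <+> ?L) a (\<lambda>p. C p q) = comb K (\<lambda>p. a (Inl p)) (\<lambda>p. C (Inl p) q) \<oplus>\<^bsub>M\<^esub>
      comb ?L (\<lambda>p. a (Inr p)) (\<lambda>p. C (Inr p) q)"
    if "K \<subseteq> insert z I" "\<And>p. p \<in> K <+> ?L \<Longrightarrow> a p \<in> carrier M" "q \<in> insert z I <+> ?L" for K a q
    using that fin r(1) finite_subset[of K "insert z I"] by (intro comb_Plus) (auto intro!: C_cl)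
  have col_A: "comb (K <+> ?L) a (\<lambda>p. C p (Inl q)) = comb K (\<lambda>p. a (Inl p)) (\<lambda>p. A p q)"
    if K: "K \<subseteq> insert z I" and a: "\<And>p. p \<in> K <+> ?L \<Longrightarrow> a p \<in> carrier M" and q: "q \<in> I" for K a q
  proof -
    have aL: "\<And>p. p \<in> K \<Longrightarrow> a (Inl p) \<in> carrier M" and aR: "\<And>p. p \<in> ?L \<Longrightarrow> a (Inr p) \<in> carrier M"
      using a by auto
    have "comb ?L (\<lambda>p. a (Inr p)) (\<lambda>p. C (Inr p) (Inl q)) = \<zero>\<^bsub>M\<^esub>"
      using aL aR q zw by (intro comb_eq_zero) (auto simp: C_def)
    moreover have "comb K (\<lambda>p. a (Inl p)) (\<lambda>p. C (Inl p) (Inl q)) = comb K (\<lambda>p. a (Inl p)) (\<lambda>p. A p q)"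
      using aL aR q zw A K by (intro comb_cong) (auto simp: C_def)
    moreover have "comb K (\<lambda>p. a (Inl p)) (\<lambda>p. A p q) \<in> carrier M"
      using aL aR q A K by (intro comb_closed) auto
    ultimately show ?thesis using split[of K a "Inl q", OF K a] q by auto
  qed
  have col_B: "comb (K <+> ?L) a (\<lambda>p. C p (Inr q)) = comb ?L (\<lambda>p. a (Inr p)) (\<lambda>p. B p q)"
    if K: "K \<subseteq> insert z I" and a: "\<And>p. p \<in> K <+> ?L \<Longrightarrow> a p \<in> carrier M" and q: "q \<in> J" for K a q
  proof -
    have aL: "\<And>p. p \<in> K \<Longrightarrow> a (Inl p) \<in> carrier M" and aR: "\<And>p. p \<in> ?L \<Longrightarrow> a (Inr p) \<in> carrier M"
      using a by auto
    have "comb K (\<lambda>p. a (Inl p)) (\<lambda>p. C (Inl p) (Inr q)) = \<zero>\<^bsub>M\<^esub>"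
      using aL aR q zw by (intro comb_eq_zero) (auto simp: C_def)
    moreover have "comb ?L (\<lambda>p. a (Inr p)) (\<lambda>p. C (Inr p) (Inr q)) = comb ?L (\<lambda>p. a (Inr p)) (\<lambda>p. B p q)"
      using aL aR q zw r(3) by (intro comb_cong) (auto simp: C_def)
    moreover have "comb ?L (\<lambda>p. a (Inr p)) (\<lambda>p. B p q) \<in> carrier M"
      using aL aR q r(3) by (intro comb_closed) auto
    ultimately show ?thesis using split[of K a "Inr q", OF K a] q by auto
  qed
  have col_w: "comb (K <+> ?L) a (\<lambda>p. C p (Inr w)) = comb K (\<lambda>p. a (Inl p)) u \<ominus>\<^bsub>M\<^esub> a (Inr w)"
    if K: "K \<subseteq> insert z I" and a: "\<And>p. p \<in> K <+> ?L \<Longrightarrow> a p \<in> carrier M" for K a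
  proof -
    have aL: "\<And>p. p \<in> K \<Longrightarrow> a (Inl p) \<in> carrier M" and aR: "\<And>p. p \<in> ?L \<Longrightarrow> a (Inr p) \<in> carrier M"
      using a by auto
    have "comb ?L (\<lambda>p. a (Inr p)) (\<lambda>p. C (Inr p) (Inr w)) = a (Inr w) \<star>\<^bsub>M\<^esub> C (Inr w) (Inr w)"
      using aL aR r(1) by (intro comb_single) (auto simp: C_def)
    also have "\<dots> = \<ominus>\<^bsub>M\<^esub> a (Inr w)"
      using aL aR by (auto simp: C_def rsmult_minus_right)
    moreover have "comb K (\<lambda>p. a (Inl p)) (\<lambda>p. C (Inl p) (Inr w)) = comb K (\<lambda>p. a (Inl p)) u"
      using aL aR u K by (intro comb_cong) (auto simp: C_def)
    ultimately show ?thesis using split[of K a "Inr w", OF K a] by (auto simp: M.minus_eq)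
  qed
  have col_z: "comb (insert z I <+> ?L) a (\<lambda>p. C p (Inl z)) =
      comb (insert z I) (\<lambda>p. a (Inl p)) v \<oplus>\<^bsub>M\<^esub> comb ?L (\<lambda>p. a (Inr p)) (\<lambda>p. B p w)"
    if a: "\<And>p. p \<in> insert z I <+> ?L \<Longrightarrow> a p \<in> carrier M" for a
  proof -
    have aL: "\<And>p. p \<in> insert z I \<Longrightarrow> a (Inl p) \<in> carrier M" and aR: "\<And>p. p \<in> ?L \<Longrightarrow> a (Inr p) \<in> carrier M"
      using a by auto
    have "comb (insert z I) (\<lambda>p. a (Inl p)) (\<lambda>p. C (Inl p) (Inl z)) = comb (insert z I) (\<lambda>p. a (Inl p)) v"
      using aL aR v by (intro comb_cong) (auto simp: C_def)
    moreover have "comb ?L (\<lambda>p. a (Inr p)) (\<lambda>p. C (Inr p) (Inl z)) = comb ?L (\<lambda>p. a (Inr p)) (\<lambda>p. B p w)"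
      using aL aR r(3) by (intro comb_cong) (auto simp: C_def)
    ultimately show ?thesis using split[of "insert z I" a "Inl z", OF order_refl a] by auto
  qed
  have I_sub: "I \<subseteq> insert z I" by auto
  \<comment> \<open>The block is triangular. The entries on \<open>I\<close> are found from
    \<open>A\<close>, column \<open>Inr w\<close> then fixes the entry in row \<open>Inr w\<close>,
    and the entries on \<open>J\<close> are found last from \<open>B\<close>. The kernel is shown to
    vanish in the same order.\<close>
  have "nonsing (I <+> ?L) (I <+> ?L) C"
    unfolding nonsing_def
  proof (intro conjI ballI impI)
    fix t assume t: "t \<in> I <+> ?L \<rightarrow> carrier M"
    have "t (Inl q) \<in> carrier M" if "q \<in> I" for q using t that by auto
    then obtain a1 where a1: "\<And>p. p \<in> I \<Longrightarrow> a1 p \<in> carrier M"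
      "\<And>q. q \<in> I \<Longrightarrow> comb I a1 (\<lambda>p. A p q) = t (Inl q)"
      using nonsing_solve[OF ns, of "\<lambda>q. t (Inl q)"] by blast
    have c: "comb I a1 u \<in> carrier M" and tw: "t (Inr w) \<in> carrier M"
      using a1 u t by auto
    then have x: "comb I a1 u \<ominus>\<^bsub>M\<^esub> t (Inr w) \<in> carrier M" by auto
    have "t (Inr q) \<in> carrier M" if "q \<in> J" for q using t that by auto
    then obtain a2 where a2: "a2 w = comb I a1 u \<ominus>\<^bsub>M\<^esub> t (Inr w)"
      "\<And>p. p \<in> ?L \<Longrightarrow> a2 p \<in> carrier M"
      "\<And>q. q \<in> J \<Longrightarrow> comb ?L a2 (\<lambda>p. B p q) = t (Inr q)"
      using nonsing_solve_insert[OF r(1,2) _ r(4) x, of "\<lambda>q. t (Inr q)"] r(3) by blast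
    let ?a = "case_sum a1 a2"
    have a: "\<And>p. p \<in> I <+> ?L \<Longrightarrow> ?a p \<in> carrier M" using a1(1) a2(2) by auto
    have "comb (I <+> ?L) ?a (\<lambda>p. C p q) = t q" if q: "q \<in> I <+> ?L" for q
    proof -
      consider q' where "q = Inl q'" "q' \<in> I" | "q = Inr w" | q' where "q = Inr q'" "q' \<in> J"
        using q by auto
      then show ?thesis
      proof cases
        case 1
        then show ?thesis using col_A[of I ?a, OF I_sub a] a1(2) by simp
      next
        case 2
        have "comb I a1 u \<ominus>\<^bsub>M\<^esub> (comb I a1 u \<ominus>\<^bsub>M\<^esub> t (Inr w)) = t (Inr w)"
          using c tw by (simp add: M.minus_eq M.minus_add M.a_assoc[symmetric] M.r_neg)
        then show ?thesis using 2 col_w[of I ?a, OF I_sub a] a2(1) by simp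
      next
        case 3
        then show ?thesis using col_B[of I ?a, OF I_sub a] a2(3) by simp
      qed
    qed
    then show "\<exists>a\<in>I <+> ?L \<rightarrow> carrier M. \<forall>q\<in>I <+> ?L. comb (I <+> ?L) a (\<lambda>p. C p q) = t q"
      using a by (intro bexI[of _ ?a]) auto
  next
    fix a p assume a0: "a \<in> I <+> ?L \<rightarrow> carrier M" "\<forall>q\<in>I <+> ?L. comb (I <+> ?L) a (\<lambda>p. C p q) = \<zero>\<^bsub>M\<^esub>"
      and p: "p \<in> I <+> ?L"
    have a: "\<And>p. p \<in> I <+> ?L \<Longrightarrow> a p \<in> carrier M" using a0 by auto
    have aI: "a (Inl q) = \<zero>\<^bsub>M\<^esub>" if "q \<in> I" for q
    proof (rule nonsing_kernel[OF ns, of "\<lambda>p. a (Inl p)"])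
      fix j assume "j \<in> I"
      then show "comb I (\<lambda>p. a (Inl p)) (\<lambda>p. A p j) = \<zero>\<^bsub>M\<^esub>"
        using bspec[OF a0(2) InlI] col_A[of I a j, OF I_sub a] by simp
    qed (use a that in auto)
    have "comb I (\<lambda>p. a (Inl p)) u = \<zero>\<^bsub>M\<^esub>"
      using aI u by (intro comb_eq_zero) auto
    moreover have "comb (I <+> ?L) a (\<lambda>p. C p (Inr w)) = \<zero>\<^bsub>M\<^esub>" using a0(2) by auto
    moreover have aw_cl: "a (Inr w) \<in> carrier M" using a by auto
    ultimately have "\<ominus>\<^bsub>M\<^esub> a (Inr w) = \<zero>\<^bsub>M\<^esub>"
      using col_w[of I a, OF I_sub a] by (simp add: M.minus_eq)
    then have aw: "a (Inr w) = \<zero>\<^bsub>M\<^esub>"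
      using M.r_neg[OF aw_cl] aw_cl by simp
    have aJ: "a (Inr q) = \<zero>\<^bsub>M\<^esub>" if "q \<in> J" for q
    proof (rule nonsing_kernel[OF r(4), of "\<lambda>p. a (Inr p)"])
      fix j assume j: "j \<in> J"
      have "comb J (\<lambda>p. a (Inr p)) (\<lambda>p. B p j) = comb ?L (\<lambda>p. a (Inr p)) (\<lambda>p. B p j)"
        using a aw r(1,3) j by (intro comb_mono_neutral[symmetric]) auto
      also have "\<dots> = \<zero>\<^bsub>M\<^esub>"
        using bspec[OF a0(2) InrI[OF insertI2[OF j]]] col_B[of I a j, OF I_sub a j] by simp
      finally show "comb J (\<lambda>p. a (Inr p)) (\<lambda>p. B p j) = \<zero>\<^bsub>M\<^esub>" .
    qed (use a that in auto)
    show "a p = \<zero>\<^bsub>M\<^esub>" using p aI aw aJ by auto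
  qed
  moreover have "comb (insert (Inl z) (I <+> ?L)) a (\<lambda>p. C p (Inl z)) = g (a (Inl z)) \<oplus>\<^bsub>M\<^esub> e (f (a (Inl z)))"
    if sol: "solution (Inl z) (I <+> ?L) C a" for a
  proof -
    have ins: "insert (Inl z) (I <+> ?L) = insert z I <+> ?L" by auto
    have a: "\<And>p. p \<in> insert z I <+> ?L \<Longrightarrow> a p \<in> carrier M"
      and a_eq: "\<And>q. q \<in> I <+> ?L \<Longrightarrow> comb (insert z I <+> ?L) a (\<lambda>p. C p q) = \<zero>\<^bsub>M\<^esub>"
      using sol unfolding solution_def ins by blast+
    have aL: "\<And>p. p \<in> insert z I \<Longrightarrow> a (Inl p) \<in> carrier M" and aR: "\<And>p. p \<in> ?L \<Longrightarrow> a (Inr p) \<in> carrier M"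
      using a by auto
    have eqL: "comb (insert z I) (\<lambda>p. a (Inl p)) (\<lambda>p. A p q) = \<zero>\<^bsub>M\<^esub>" if "q \<in> I" for q
      using col_A[of "insert z I" a q, OF order_refl a that] a_eq[OF InlI[OF that]] by simp
    have eqR: "comb ?L (\<lambda>p. a (Inr p)) (\<lambda>p. B p q) = \<zero>\<^bsub>M\<^esub>" if "q \<in> J" for q
      using col_B[of "insert z I" a q, OF order_refl a that] a_eq[OF InrI[OF insertI2[OF that]]] by simp
    have sA: "solution z I A (\<lambda>p. a (Inl p))"
      unfolding solution_def using aL eqL by blast
    have sB: "solution w J B (\<lambda>p. a (Inr p))"
      unfolding solution_def using aR eqR by blast
    have c: "comb (insert z I) (\<lambda>p. a (Inl p)) u \<in> carrier M" using a u by (intro comb_closed) auto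
    have aw: "a (Inr w) \<in> carrier M" using a by auto
    have "comb (insert z I) (\<lambda>p. a (Inl p)) u \<ominus>\<^bsub>M\<^esub> a (Inr w) = \<zero>\<^bsub>M\<^esub>"
      using col_w[of "insert z I" a, OF order_refl a] a_eq[OF InrI[OF insertI1]] by simp
    then have "a (Inr w) = f (a (Inl z))"
      using f[OF sA] c aw M.minus_equality[of "f (a (Inl z))" "\<ominus>\<^bsub>M\<^esub> a (Inr w)"] by (simp add: M.minus_eq)
    then show ?thesis
      unfolding ins using col_z[of a, OF a] g[OF sA] r(5)[OF sB] by simp
  qed
  moreover have "insert (Inl z) (I <+> ?L) = insert z I <+> ?L" by auto
  ultimately show ?thesis
    unfolding represents_def using fin r(1) C_cl by (intro exI[of _ C]) auto
qed

section \<open>Ring operations and inverses of representable maps\<close>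

lemma represents_rsmult:
  assumes "r \<in> carrier R"
  shows "represents z {} (\<lambda>_ _. r) (\<lambda>m. m \<star>\<^bsub>M\<^esub> r)"
proof -
  \<comment> \<open>With \<open>I\<close> empty there are no equations, and the bordered matrix
    reduces to its corner \<open>r\<close>.\<close>
  have "comb {z} a (\<lambda>_. r) = a z \<star>\<^bsub>M\<^esub> r" if "a z \<in> carrier M" for a
    using comb_insert[of "{}" z a "\<lambda>_. r"] assms that by simp
  then show ?thesis
    unfolding represents_def solution_def using assms nonsing_empty by simp
qed

lemma represents_sum:
  assumes d: "represents z I A d" and e: "represents w J B e"
  shows "\<exists>C. represents (Inl z) (I <+> insert w J) C (\<lambda>m. d m \<oplus>\<^bsub>M\<^esub> e m)"
proof -
  note r = representsD[OF d]
  \<comment> \<open>Taking this unit column as \<open>u\<close> reads off the input, so the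
    auxiliary output is \<open>m\<close> itself; the column \<open>z\<close> of \<open>A\<close>
    serves as \<open>v\<close> and contributes \<open>d m\<close>.\<close>
  have "comb (insert z I) a (\<lambda>p. if p = z then \<one>\<^bsub>R\<^esub> else \<zero>\<^bsub>R\<^esub>) = a z" if "solution z I A a" for a
    using r(1) solution_closed[OF that] by (subst comb_single[of _ z]) auto
  then show ?thesis
    using represents_compose[OF r(1,2) _ r(4) _ _ _ r(5) e,
      of "\<lambda>p. if p = z then \<one>\<^bsub>R\<^esub> else \<zero>\<^bsub>R\<^esub>" "\<lambda>m. m"] r(3) by auto
qed

lemma represents_comp:
  assumes d: "represents z I A d" and e: "represents w J B e"
  shows "\<exists>C. represents (Inl z) (I <+> insert w J) C (\<lambda>m. e (d m))"
proof -
  note r = representsD[OF d]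
  \<comment> \<open>Here the column \<open>z\<close> of \<open>A\<close> serves as \<open>u\<close>,
    so the input of \<open>B\<close> is \<open>d m\<close>. The zero column is taken as
    \<open>v\<close>, which leaves only the output of \<open>B\<close>.\<close>
  have "comb (insert z I) a (\<lambda>p. \<zero>\<^bsub>R\<^esub>) = \<zero>\<^bsub>M\<^esub>" if "solution z I A a" for a
    using solution_closed[OF that] by (intro comb_eq_zero) auto
  then obtain C where "represents (Inl z) (I <+> insert w J) C (\<lambda>m. \<zero>\<^bsub>M\<^esub> \<oplus>\<^bsub>M\<^esub> e (d m))"
    using represents_compose[OF r(1,2) _ r(4) _ _ r(5) _ e,
      of "\<lambda>p. \<zero>\<^bsub>R\<^esub>" "\<lambda>m. \<zero>\<^bsub>M\<^esub>"] r(3) by auto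
  then have "represents (Inl z) (I <+> insert w J) C (\<lambda>m. e (d m))"
    by (rule represents_cong) (simp add: represents_closed[OF d] represents_closed[OF e])
  then show ?thesis by blast
qed

text \<open>The kernel in \<open>kernel_dichotomy\<close> consists of the solutions. Since every
  \<open>m\<close> is the input of one, the first alternative there says that \<open>d\<close>
  vanishes on $M$.\<close>

lemma represents_dichotomy:
  assumes E: "E_condition R M (Suc (card I))" and d: "represents z I A d"
  shows "(\<forall>m\<in>carrier M. d m = \<zero>\<^bsub>M\<^esub>) \<or> nonsing (insert z I) (insert z I) A"
proof -
  note r = representsD[OF d]
  have "d m = \<zero>\<^bsub>M\<^esub>" if m: "m \<in> carrier M" and
    k: "\<forall>a. (\<forall>p\<in>insert z I. a p \<in> carrier M) \<longrightarrow>
      (\<forall>q\<in>I. comb (insert z I) a (\<lambda>p. A p q) = \<zero>\<^bsub>M\<^esub>) \<longrightarrow>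
      comb (insert z I) a (\<lambda>p. A p z) = \<zero>\<^bsub>M\<^esub>" for m
  proof -
    obtain a where "solution z I A a" "comb (insert z I) a (\<lambda>p. A p z) = d m"
      using represents_solution[OF d m] by blast
    then show ?thesis using k unfolding solution_def by metis
  qed
  then show ?thesis
    using kernel_dichotomy[OF E r(1,1) refl r(2,2,3,4)] by blast
qed

text \<open>Prescribing \<open>m\<close> in column \<open>z\<close> and zero in the columns of
  \<open>I\<close> gives a solution whose input is a preimage of \<open>m\<close>. A solution with
  output zero vanishes altogether, input included, and additivity turns this into
  injectivity.\<close>

lemma represents_bij:
  assumes d: "represents z I A d" and ns: "nonsing (insert z I) (insert z I) A"
  shows "bij_betw d (carrier M) (carrier M)"
proof -
  note r = representsD[OF d]
  have ker: "x = \<zero>\<^bsub>M\<^esub>" if x: "x \<in> carrier M" "d x = \<zero>\<^bsub>M\<^esub>" for x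
  proof -
    obtain a where a: "solution z I A a" "a z = x" "comb (insert z I) a (\<lambda>p. A p z) = d x"
      using represents_solution[OF d x(1)] by blast
    have "a z = \<zero>\<^bsub>M\<^esub>"
      by (rule nonsing_kernel[OF ns, of a]) (use a x(2) in \<open>auto simp: solution_def\<close>)
    then show ?thesis using a(2) by simp
  qed
  show ?thesis
  proof (rule bij_betw_imageI)
    show "inj_on d (carrier M)"
    proof (rule inj_onI)
      fix x y assume x: "x \<in> carrier M" and y: "y \<in> carrier M" and eq: "d x = d y"
      have "d (x \<ominus>\<^bsub>M\<^esub> y) \<oplus>\<^bsub>M\<^esub> d y = d (x \<ominus>\<^bsub>M\<^esub> y \<oplus>\<^bsub>M\<^esub> y)"
        using represents_add[OF d] x y by simp
      also have "x \<ominus>\<^bsub>M\<^esub> y \<oplus>\<^bsub>M\<^esub> y = x"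
        using x y by (simp add: M.minus_eq M.a_assoc M.l_neg)
      finally have "d (x \<ominus>\<^bsub>M\<^esub> y) = \<zero>\<^bsub>M\<^esub>"
        using represents_closed[OF d] x y eq by (metis M.add.l_cancel_one M.minus_closed M.a_comm)
      then have "x \<ominus>\<^bsub>M\<^esub> y = \<zero>\<^bsub>M\<^esub>" using ker x y by simp
      then show "x = y"
        using x y M.minus_equality[of x "\<ominus>\<^bsub>M\<^esub> y"] by (simp add: M.minus_eq)
    qed
    show "d ` carrier M = carrier M"
    proof
      show "d ` carrier M \<subseteq> carrier M" using represents_closed[OF d] by auto
      show "carrier M \<subseteq> d ` carrier M"
      proof
        fix m assume m: "m \<in> carrier M"
        have "(\<lambda>q. if q = z then m else \<zero>\<^bsub>M\<^esub>) \<in> insert z I \<rightarrow> carrier M" using m by auto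
        from bspec[OF conjunct1[OF ns[unfolded nonsing_def]] this]
        obtain a where a: "a \<in> insert z I \<rightarrow> carrier M"
          "\<forall>q\<in>insert z I. comb (insert z I) a (\<lambda>p. A p q) = (if q = z then m else \<zero>\<^bsub>M\<^esub>)"
          by blast
        then have "solution z I A a" using r(2) unfolding solution_def by auto
        then have "d (a z) = m" using r(5)[of a] a by auto
        moreover have "a z \<in> carrier M" using a by auto
        ultimately show "m \<in> d ` carrier M" by blast
      qed
    qed
  qed
qed

text \<open>For the inverse, the old output becomes a prescribed right-hand side, moved to the left
  as the new input \<open>None\<close>, and the old input is read off as output.\<close>

lemma represents_inv_into:
  assumes d: "represents z I A d" and ns: "nonsing (insert z I) (insert z I) A"
  shows "\<exists>C. represents None (Some ` insert z I) C (inv_into (carrier M) d)"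
proof -
  note r = representsD[OF d]
  let ?K = "insert z I"
  \<comment> \<open>The block is \<open>A\<close>. The input row \<open>None\<close> has $-1$ in
    column \<open>Some z\<close>, so that the equation there says that the old output equals the new
    input. The output column \<open>None\<close> has its only nontrivial entry $1$ in row
    \<open>Some z\<close> and so returns the old input.\<close>
  define C where "C = case_option
    (case_option \<zero>\<^bsub>R\<^esub> (\<lambda>q. if q = z then \<ominus>\<^bsub>R\<^esub> \<one>\<^bsub>R\<^esub> else \<zero>\<^bsub>R\<^esub>))
    (\<lambda>p. case_option (if p = z then \<one>\<^bsub>R\<^esub> else \<zero>\<^bsub>R\<^esub>) (\<lambda>q. A p q))"
  have C_cl: "C p q \<in> carrier R" if "p \<in> insert None (Some ` ?K)" "q \<in> insert None (Some ` ?K)" for p q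
    using that r(3) by (auto simp: C_def)
  have split: "comb (insert None (Some ` ?K)) a (\<lambda>p. C p q) =
      a None \<star>\<^bsub>M\<^esub> C None q \<oplus>\<^bsub>M\<^esub> comb ?K (\<lambda>p. a (Some p)) (\<lambda>p. C (Some p) q)"
    if a: "\<And>p. p \<in> insert None (Some ` ?K) \<Longrightarrow> a p \<in> carrier M" and q: "q \<in> insert None (Some ` ?K)" for a q
  proof -
    have "comb (insert None (Some ` ?K)) a (\<lambda>p. C p q) =
        a None \<star>\<^bsub>M\<^esub> C None q \<oplus>\<^bsub>M\<^esub> comb (Some ` ?K) a (\<lambda>p. C p q)"
      by (rule comb_insert) (use a q r(1) C_cl in blast)+
    also have "comb (Some ` ?K) a (\<lambda>p. C p q) = comb ?K (\<lambda>p. a (Some p)) (\<lambda>p. C (Some p) q)"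
      by (rule comb_reindex) (use a q C_cl in auto)
    finally show ?thesis .
  qed
  have "nonsing (Some ` ?K) (Some ` ?K) C \<longleftrightarrow> nonsing ?K ?K (\<lambda>p q. C (Some p) (Some q))"
    by (rule nonsing_reindex) (use C_cl in \<open>auto simp: inj_on_def\<close>)
  then have nsC: "nonsing (Some ` ?K) (Some ` ?K) C"
    using ns by (simp add: C_def)
  have out: "comb (insert None (Some ` ?K)) a (\<lambda>p. C p None) = inv_into (carrier M) d (a None)"
    if sol: "solution None (Some ` ?K) C a" for a
  proof -
    have a: "\<And>p. p \<in> insert None (Some ` ?K) \<Longrightarrow> a p \<in> carrier M"
      and a_eq: "\<And>q. q \<in> ?K \<Longrightarrow> comb (insert None (Some ` ?K)) a (\<lambda>p. C p (Some q)) = \<zero>\<^bsub>M\<^esub>"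
      using sol unfolding solution_def by blast+
    have aS: "\<And>p. p \<in> ?K \<Longrightarrow> a (Some p) \<in> carrier M" and aN: "a None \<in> carrier M"
      using a by auto
    have c: "comb ?K (\<lambda>p. a (Some p)) (\<lambda>p. A p q) \<in> carrier M" if "q \<in> ?K" for q
      using aS r(3) that by (intro comb_closed) auto
    have eq: "a None \<star>\<^bsub>M\<^esub> C None (Some q) \<oplus>\<^bsub>M\<^esub> comb ?K (\<lambda>p. a (Some p)) (\<lambda>p. A p q) = \<zero>\<^bsub>M\<^esub>"
      if "q \<in> ?K" for q
    proof -
      have "Some q \<in> insert None (Some ` ?K)" using that by blast
      moreover have "(\<lambda>p. C (Some p) (Some q)) = (\<lambda>p. A p q)" by (simp add: C_def)
      ultimately show ?thesis using split[of a "Some q", OF a] a_eq[OF that] by simp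
    qed
    have "comb ?K (\<lambda>p. a (Some p)) (\<lambda>p. A p q) = \<zero>\<^bsub>M\<^esub>" if "q \<in> I" for q
    proof -
      have "C None (Some q) = \<zero>\<^bsub>R\<^esub>" using that r(2) by (auto simp: C_def)
      then show ?thesis using eq[of q] c[of q] aN that by simp
    qed
    then have solA: "solution z I A (\<lambda>p. a (Some p))"
      using aS unfolding solution_def by auto
    have "\<ominus>\<^bsub>M\<^esub> a None \<oplus>\<^bsub>M\<^esub> d (a (Some z)) = \<zero>\<^bsub>M\<^esub>"
      using eq[of z] r(5)[OF solA] aN by (simp add: C_def rsmult_minus_right)
    then have "d (a (Some z)) = a None"
      using aN c[of z] r(5)[OF solA] M.minus_equality[of "\<ominus>\<^bsub>M\<^esub> a None" "d (a (Some z))"]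
      by (metis M.a_inv_closed M.minus_minus insertI1)
    then have "inv_into (carrier M) d (a None) = a (Some z)"
      using represents_bij[OF d ns] aS by (metis bij_betw_inv_into_left insertI1)
    moreover have "comb ?K (\<lambda>p. a (Some p)) (\<lambda>p. C (Some p) None) = a (Some z)"
      using aS r(1) by (subst comb_single[of _ z]) (auto simp: C_def)
    ultimately show ?thesis
      using split[of a None, OF a] aN aS by (simp add: C_def)
  qed
  have "represents None (Some ` ?K) C (inv_into (carrier M) d)"
    unfolding represents_def using r(1) C_cl nsC out by blast
  then show ?thesis by blast
qed

text \<open>Endomorphisms act on the right, so the product applies the left factor first.
  Restricting to extensional functions makes two maps equal as soon as they agree on $M$.\<close>

definition rational_closure :: "('c \<Rightarrow> 'c) ring" where
  "rational_closure = \<lparr>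
    carrier = {d \<in> extensional (carrier M). \<exists>n (A :: nat \<Rightarrow> nat \<Rightarrow> 'a). represents n {..<n} A d},
    mult = (\<lambda>d e. \<lambda>m\<in>carrier M. e (d m)),
    one = (\<lambda>m\<in>carrier M. m),
    zero = (\<lambda>m\<in>carrier M. \<zero>\<^bsub>M\<^esub>),
    add = (\<lambda>d e. \<lambda>m\<in>carrier M. d m \<oplus>\<^bsub>M\<^esub> e m)\<rparr>"

lemma rational_closure_simps:
  "d \<otimes>\<^bsub>rational_closure\<^esub> e = (\<lambda>m\<in>carrier M. e (d m))"
  "d \<oplus>\<^bsub>rational_closure\<^esub> e = (\<lambda>m\<in>carrier M. d m \<oplus>\<^bsub>M\<^esub> e m)"
  "\<one>\<^bsub>rational_closure\<^esub> = (\<lambda>m\<in>carrier M. m)"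
  "\<zero>\<^bsub>rational_closure\<^esub> = (\<lambda>m\<in>carrier M. \<zero>\<^bsub>M\<^esub>)"
  by (simp_all add: rational_closure_def)

lemma rational_closureE:
  assumes "d \<in> carrier rational_closure"
  obtains n and A :: "nat \<Rightarrow> nat \<Rightarrow> 'a" where "d \<in> extensional (carrier M)" "represents n {..<n} A d"
  using assms by (auto simp: rational_closure_def)

lemma restrict_mem_rational_closure:
  assumes "represents z I A d"
  shows "restrict d (carrier M) \<in> carrier rational_closure"
proof -
  have "represents z I A (restrict d (carrier M))"
    using assms by (rule represents_cong) simp
  then obtain n and A' :: "nat \<Rightarrow> nat \<Rightarrow> 'a" where "represents n {..<n} A' (restrict d (carrier M))"
    by (rule represents_lessThan)
  then show ?thesis by (auto simp: rational_closure_def)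
qed

lemma rational_closure_closed:
  "d \<in> carrier rational_closure \<Longrightarrow> m \<in> carrier M \<Longrightarrow> d m \<in> carrier M"
  by (erule rational_closureE) (rule represents_closed)

lemma rational_closure_additive:
  "d \<in> carrier rational_closure \<Longrightarrow> m \<in> carrier M \<Longrightarrow> m' \<in> carrier M \<Longrightarrow>
    d (m \<oplus>\<^bsub>M\<^esub> m') = d m \<oplus>\<^bsub>M\<^esub> d m'"
  by (erule rational_closureE) (rule represents_add)

lemma rational_closure_eqI:
  assumes "d \<in> carrier rational_closure" "e \<in> carrier rational_closure"
    and "\<And>m. m \<in> carrier M \<Longrightarrow> d m = e m"
  shows "d = e"
  using assms by (auto elim!: rational_closureE intro: extensionalityI)

lemma rsmult_mem_rational_closure:
  "r \<in> carrier R \<Longrightarrow> (\<lambda>m\<in>carrier M. m \<star>\<^bsub>M\<^esub> r) \<in> carrier rational_closure"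
  by (rule restrict_mem_rational_closure[OF represents_rsmult])

lemma rational_closure_add_closed:
  assumes "d \<in> carrier rational_closure" "e \<in> carrier rational_closure"
  shows "d \<oplus>\<^bsub>rational_closure\<^esub> e \<in> carrier rational_closure"
proof -
  obtain n and A :: "nat \<Rightarrow> nat \<Rightarrow> 'a" where d: "represents n {..<n} A d"
    using assms(1) by (rule rational_closureE)
  obtain k and B :: "nat \<Rightarrow> nat \<Rightarrow> 'a" where e: "represents k {..<k} B e"
    using assms(2) by (rule rational_closureE)
  obtain C where "represents (Inl n) ({..<n} <+> insert k {..<k}) C (\<lambda>m. d m \<oplus>\<^bsub>M\<^esub> e m)"
    using represents_sum[OF d e] by blast
  then show ?thesis
    unfolding rational_closure_simps by (rule restrict_mem_rational_closure)
qed

lemma rational_closure_mult_closed: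
  assumes "d \<in> carrier rational_closure" "e \<in> carrier rational_closure"
  shows "d \<otimes>\<^bsub>rational_closure\<^esub> e \<in> carrier rational_closure"
proof -
  obtain n and A :: "nat \<Rightarrow> nat \<Rightarrow> 'a" where d: "represents n {..<n} A d"
    using assms(1) by (rule rational_closureE)
  obtain k and B :: "nat \<Rightarrow> nat \<Rightarrow> 'a" where e: "represents k {..<k} B e"
    using assms(2) by (rule rational_closureE)
  obtain C where "represents (Inl n) ({..<n} <+> insert k {..<k}) C (\<lambda>m. e (d m))"
    using represents_comp[OF d e] by blast
  then show ?thesis
    unfolding rational_closure_simps by (rule restrict_mem_rational_closure)
qed

lemma rational_closure_one_closed: "\<one>\<^bsub>rational_closure\<^esub> \<in> carrier rational_closure"
proof -
  have "(\<lambda>m\<in>carrier M. m \<star>\<^bsub>M\<^esub> \<one>\<^bsub>R\<^esub>) = (\<lambda>m\<in>carrier M. m)" by (rule restrict_ext) simp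
  then show ?thesis
    using rsmult_mem_rational_closure[of "\<one>\<^bsub>R\<^esub>"] unfolding rational_closure_simps by simp
qed

lemma rational_closure_zero_closed: "\<zero>\<^bsub>rational_closure\<^esub> \<in> carrier rational_closure"
proof -
  have "(\<lambda>m\<in>carrier M. m \<star>\<^bsub>M\<^esub> \<zero>\<^bsub>R\<^esub>) = (\<lambda>m\<in>carrier M. \<zero>\<^bsub>M\<^esub>)" by (rule restrict_ext) simp
  then show ?thesis
    using rsmult_mem_rational_closure[of "\<zero>\<^bsub>R\<^esub>"] unfolding rational_closure_simps by simp
qed

lemma ring_rational_closure: "ring rational_closure"
proof (rule ringI)
  note closed = rational_closure_add_closed rational_closure_mult_closed
    rational_closure_one_closed rational_closure_zero_closed
  note vals = rational_closure_simps rational_closure_closed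
  show "abelian_group rational_closure"
  proof (rule abelian_groupI)
    fix x assume x: "x \<in> carrier rational_closure"
    \<comment> \<open>The additive inverse is the composite of \<open>x\<close> with the action of
      $-1$.\<close>
    let ?y = "x \<otimes>\<^bsub>rational_closure\<^esub> (\<lambda>m\<in>carrier M. m \<star>\<^bsub>M\<^esub> (\<ominus>\<^bsub>R\<^esub> \<one>\<^bsub>R\<^esub>))"
    have y: "?y \<in> carrier rational_closure"
      using x by (intro closed rsmult_mem_rational_closure) auto
    moreover have "?y \<oplus>\<^bsub>rational_closure\<^esub> x = \<zero>\<^bsub>rational_closure\<^esub>"
    proof (rule rational_closure_eqI[OF closed(1)[OF y x] closed(4)])
      fix m assume "m \<in> carrier M"
      then show "(?y \<oplus>\<^bsub>rational_closure\<^esub> x) m = \<zero>\<^bsub>rational_closure\<^esub> m"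
        using rational_closure_closed[OF x]
        by (simp add: rational_closure_simps rsmult_minus_right M.l_neg)
    qed
    ultimately show "\<exists>y\<in>carrier rational_closure. y \<oplus>\<^bsub>rational_closure\<^esub> x = \<zero>\<^bsub>rational_closure\<^esub>"
      by blast
  next
    fix x y z assume "x \<in> carrier rational_closure" "y \<in> carrier rational_closure" "z \<in> carrier rational_closure"
    then show "x \<oplus>\<^bsub>rational_closure\<^esub> y \<oplus>\<^bsub>rational_closure\<^esub> z = x \<oplus>\<^bsub>rational_closure\<^esub> (y \<oplus>\<^bsub>rational_closure\<^esub> z)"
      by (intro rational_closure_eqI closed) (auto simp: vals M.a_assoc)
  next
    fix x y assume "x \<in> carrier rational_closure" "y \<in> carrier rational_closure"
    then show "x \<oplus>\<^bsub>rational_closure\<^esub> y = y \<oplus>\<^bsub>rational_closure\<^esub> x"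
      by (intro rational_closure_eqI closed) (auto simp: vals M.a_comm)
  next
    fix x assume "x \<in> carrier rational_closure"
    then show "\<zero>\<^bsub>rational_closure\<^esub> \<oplus>\<^bsub>rational_closure\<^esub> x = x"
      by (intro rational_closure_eqI closed) (auto simp: vals)
  qed (rule closed | assumption)+
  show "monoid rational_closure"
  proof (rule monoidI)
    fix x y z assume "x \<in> carrier rational_closure" "y \<in> carrier rational_closure" "z \<in> carrier rational_closure"
    then show "x \<otimes>\<^bsub>rational_closure\<^esub> y \<otimes>\<^bsub>rational_closure\<^esub> z = x \<otimes>\<^bsub>rational_closure\<^esub> (y \<otimes>\<^bsub>rational_closure\<^esub> z)"
      by (intro rational_closure_eqI closed) (auto simp: vals)
  next
    fix x assume "x \<in> carrier rational_closure"
    then show "\<one>\<^bsub>rational_closure\<^esub> \<otimes>\<^bsub>rational_closure\<^esub> x = x"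
      by (intro rational_closure_eqI closed) (auto simp: vals)
  next
    fix x assume "x \<in> carrier rational_closure"
    then show "x \<otimes>\<^bsub>rational_closure\<^esub> \<one>\<^bsub>rational_closure\<^esub> = x"
      by (intro rational_closure_eqI closed) (auto simp: vals)
  qed (rule closed | assumption)+
  fix x y z assume xyz: "x \<in> carrier rational_closure" "y \<in> carrier rational_closure" "z \<in> carrier rational_closure"
  show "(x \<oplus>\<^bsub>rational_closure\<^esub> y) \<otimes>\<^bsub>rational_closure\<^esub> z =
    x \<otimes>\<^bsub>rational_closure\<^esub> z \<oplus>\<^bsub>rational_closure\<^esub> y \<otimes>\<^bsub>rational_closure\<^esub> z"
    using xyz by (intro rational_closure_eqI closed) (auto simp: vals rational_closure_additive)
  show "z \<otimes>\<^bsub>rational_closure\<^esub> (x \<oplus>\<^bsub>rational_closure\<^esub> y) =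
    z \<otimes>\<^bsub>rational_closure\<^esub> x \<oplus>\<^bsub>rational_closure\<^esub> z \<otimes>\<^bsub>rational_closure\<^esub> y"
    using xyz by (intro rational_closure_eqI closed) (auto simp: vals)
qed

text \<open>By \<open>rsmult_assoc\<close>, acting by a product applies the left factor first, which
  matches the multiplication chosen for the rational closure.\<close>

lemma rsmult_ring_hom:
  "(\<lambda>r. \<lambda>m\<in>carrier M. m \<star>\<^bsub>M\<^esub> r) \<in> ring_hom R rational_closure"
  by (rule ring_hom_memI)
    (auto simp: rational_closure_simps rsmult_mem_rational_closure rsmult_assoc rsmult_r_distr
      intro!: restrict_ext)

lemma inj_on_rsmult:
  assumes "faithful_right_module R M"
  shows "inj_on (\<lambda>r. \<lambda>m\<in>carrier M. m \<star>\<^bsub>M\<^esub> r) (carrier R)"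
proof (rule inj_onI)
  fix r s assume r: "r \<in> carrier R" and s: "s \<in> carrier R"
    and eq: "(\<lambda>m\<in>carrier M. m \<star>\<^bsub>M\<^esub> r) = (\<lambda>m\<in>carrier M. m \<star>\<^bsub>M\<^esub> s)"
  have "m \<star>\<^bsub>M\<^esub> (r \<oplus>\<^bsub>R\<^esub> \<ominus>\<^bsub>R\<^esub> s) = \<zero>\<^bsub>M\<^esub>" if "m \<in> carrier M" for m
    using fun_cong[OF eq, of m] r s that by (simp add: rsmult_r_distr rsmult_minus_right M.r_neg)
  then have "r \<oplus>\<^bsub>R\<^esub> \<ominus>\<^bsub>R\<^esub> s = \<zero>\<^bsub>R\<^esub>"
    using assms r s unfolding faithful_right_module_def by blast
  then show "r = s"
    using r s R.minus_equality[of r "\<ominus>\<^bsub>R\<^esub> s"] by simp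
qed

text \<open>A nonzero \<open>d\<close> does not vanish on $M$, so the dichotomy makes the whole
  bordered matrix invertible, and then \<open>represents_inv_into\<close> represents the inverse
  map. The size of the representing matrix depends on \<open>d\<close>, hence \<open>E\<close> is
  assumed for every positive index.\<close>

lemma rational_closure_inverse:
  assumes E: "\<And>n. 0 < n \<Longrightarrow> E_condition R M n"
    and d: "d \<in> carrier rational_closure" "d \<noteq> \<zero>\<^bsub>rational_closure\<^esub>"
  obtains e where "e \<in> carrier rational_closure"
    "e \<otimes>\<^bsub>rational_closure\<^esub> d = \<one>\<^bsub>rational_closure\<^esub>" "d \<otimes>\<^bsub>rational_closure\<^esub> e = \<one>\<^bsub>rational_closure\<^esub>"
proof -
  obtain n and A :: "nat \<Rightarrow> nat \<Rightarrow> 'a" where rep: "represents n {..<n} A d"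
    using d(1) by (rule rational_closureE)
  have "\<not> (\<forall>m\<in>carrier M. d m = \<zero>\<^bsub>M\<^esub>)"
    using d rational_closure_eqI[OF d(1) rational_closure_zero_closed]
    by (auto simp: rational_closure_simps)
  then have ns: "nonsing (insert n {..<n}) (insert n {..<n}) A"
    using represents_dichotomy[OF E rep] by blast
  define e where "e = (\<lambda>m\<in>carrier M. inv_into (carrier M) d m)"
  obtain C where "represents None (Some ` insert n {..<n}) C (inv_into (carrier M) d)"
    using represents_inv_into[OF rep ns] by blast
  then have e: "e \<in> carrier rational_closure"
    unfolding e_def by (rule restrict_mem_rational_closure)
  note bij = represents_bij[OF rep ns]
  have "e \<otimes>\<^bsub>rational_closure\<^esub> d = \<one>\<^bsub>rational_closure\<^esub>"
    using bij_betw_inv_into_right[OF bij]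
    by (auto simp: rational_closure_simps e_def intro!: restrict_ext)
  moreover have "d \<otimes>\<^bsub>rational_closure\<^esub> e = \<one>\<^bsub>rational_closure\<^esub>"
    using bij_betw_inv_into_left[OF bij] rational_closure_closed[OF d(1)]
    by (auto simp: rational_closure_simps e_def intro!: restrict_ext)
  ultimately show thesis using that e by blast
qed

section \<open>Transport of the division ring to lists over the ring\<close>

definition matrix_code :: "nat \<Rightarrow> (nat \<Rightarrow> nat \<Rightarrow> 'a) \<Rightarrow> 'a list" where
  "matrix_code n A = map (\<lambda>k. A (k div n) (k mod n)) [0..<n * n]"

text \<open>The length of the list is the square of the size, which recovers the size; the entry at
  row \<open>i\<close> and column \<open>j\<close> then sits at position
  \<open>i * n + j\<close>.\<close>

lemma matrix_code_eqD:
  assumes "matrix_code n A = matrix_code k B"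
  shows "n = k" "\<And>i j. i < n \<Longrightarrow> j < n \<Longrightarrow> A i j = B i j"
proof -
  have "n * n = k * k"
    using arg_cong[OF assms, of length] by (simp add: matrix_code_def)
  then show nk: "n = k"
    by (metis power2_eq_square power2_eq_iff_nonneg zero_le)
  fix i j assume ij: "i < n" "j < n"
  have "i * n + j < Suc i * n" using ij by simp
  also have "\<dots> \<le> n * n" using ij by (intro mult_le_mono1) simp
  finally have l: "i * n + j < n * n" .
  have "matrix_code n A ! (i * n + j) = matrix_code n B ! (i * n + j)"
    using assms nk by simp
  then show "A i j = B i j"
    using l ij by (simp add: matrix_code_def)
qed

text \<open>A representing matrix is chosen for each map, and by \<open>represents_unique\<close> it
  determines the map. Written as a list it places the map in the type over which
  \<open>embeds_in_division_ring\<close> quantifies.\<close>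

lemma inj_rational_closure_list:
  obtains c :: "('c \<Rightarrow> 'c) \<Rightarrow> 'a list" where "inj_on c (carrier rational_closure)"
proof -
  have "\<exists>n (A :: nat \<Rightarrow> nat \<Rightarrow> 'a). represents n {..<n} A d" if "d \<in> carrier rational_closure" for d
    using that by (auto simp: rational_closure_def)
  then obtain N and A :: "('c \<Rightarrow> 'c) \<Rightarrow> nat \<Rightarrow> nat \<Rightarrow> 'a" where
    NA: "\<And>d. d \<in> carrier rational_closure \<Longrightarrow> represents (N d) {..<N d} (A d) d"
    by metis
  \<comment> \<open>The size is \<open>Suc (N d)\<close>, since the bordered matrix also has a row
    and a column with index \<open>N d\<close>.\<close>
  have "inj_on (\<lambda>d. matrix_code (Suc (N d)) (A d)) (carrier rational_closure)"
  proof (rule inj_onI)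
    fix d e assume d: "d \<in> carrier rational_closure" and e: "e \<in> carrier rational_closure"
      and eq: "matrix_code (Suc (N d)) (A d) = matrix_code (Suc (N e)) (A e)"
    have N: "N e = N d" using matrix_code_eqD(1)[OF eq] by simp
    have "d m = e m" if "m \<in> carrier M" for m
    proof (rule represents_unique[OF NA[OF d] NA[OF e, unfolded N] that])
      fix p q assume "p \<in> insert (N d) {..<N d}" "q \<in> insert (N d) {..<N d}"
      then show "A d p q = A e p q" using matrix_code_eqD(2)[OF eq] by auto
    qed
    then show "d = e" by (rule rational_closure_eqI[OF d e])
  qed
  then show thesis by (rule that)
qed

end

text \<open>An injection on the carrier transports the ring structure to its image, and two-sided
  inverses are carried along by the resulting homomorphism. This moves the rational closure from
  functions to lists.\<close>

lemma skew_field_image_ring: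
  assumes D: "ring D" and inj: "inj_on f (carrier D)" and one: "\<one>\<^bsub>D\<^esub> \<noteq> \<zero>\<^bsub>D\<^esub>"
    and inv: "\<And>x. x \<in> carrier D \<Longrightarrow> x \<noteq> \<zero>\<^bsub>D\<^esub> \<Longrightarrow>
      \<exists>y\<in>carrier D. y \<otimes>\<^bsub>D\<^esub> x = \<one>\<^bsub>D\<^esub> \<and> x \<otimes>\<^bsub>D\<^esub> y = \<one>\<^bsub>D\<^esub>"
  shows "skew_field (image_ring f D)"
proof -
  interpret D: ring D by (rule D)
  interpret I: ring "image_ring f D" by (rule D.inj_imp_image_ring_is_ring[OF inj])
  have hom: "f \<in> ring_hom D (image_ring f D)"
    using inj_imp_image_ring_iso[OF inj] by (simp add: ring_iso_def)
  have one': "\<one>\<^bsub>image_ring f D\<^esub> \<noteq> \<zero>\<^bsub>image_ring f D\<^esub>"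
    using inj_onD[OF inj] one by (auto simp: image_ring_one image_ring_zero)
  have "x \<in> Units (image_ring f D)" if x: "x \<in> carrier (image_ring f D) - {\<zero>\<^bsub>image_ring f D\<^esub>}" for x
  proof -
    obtain d where d: "d \<in> carrier D" "x = f d" "d \<noteq> \<zero>\<^bsub>D\<^esub>"
      using x by (auto simp: image_ring_carrier image_ring_zero)
    then obtain e where e: "e \<in> carrier D" "e \<otimes>\<^bsub>D\<^esub> d = \<one>\<^bsub>D\<^esub>" "d \<otimes>\<^bsub>D\<^esub> e = \<one>\<^bsub>D\<^esub>"
      using inv by blast
    have "f e \<otimes>\<^bsub>image_ring f D\<^esub> x = \<one>\<^bsub>image_ring f D\<^esub>" "x \<otimes>\<^bsub>image_ring f D\<^esub> f e = \<one>\<^bsub>image_ring f D\<^esub>"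
      using ring_hom_mult[OF hom] ring_hom_one[OF hom] d e by metis+
    moreover have "f e \<in> carrier (image_ring f D)"
      using e by (simp add: image_ring_carrier)
    ultimately show ?thesis using x unfolding Units_def by auto
  qed
  moreover have "x \<noteq> \<zero>\<^bsub>image_ring f D\<^esub>" if "x \<in> Units (image_ring f D)" for x
    using that one' I.l_null unfolding Units_def by auto
  ultimately have "Units (image_ring f D) = carrier (image_ring f D) - {\<zero>\<^bsub>image_ring f D\<^esub>}"
    by (auto simp: Units_def)
  then show ?thesis using one' by unfold_locales auto
qed

text \<open>The embedding sends \<open>r\<close> to the code of its action on $M$. Faithfulness
  makes it injective, and a nonzero module separates one from zero in the rational closure.\<close>

lemma (in right_module) embeds_in_division_ring_if_E_condition:
  assumes E: "\<And>n. 0 < n \<Longrightarrow> E_condition R M n"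
    and nz: "carrier M \<noteq> {\<zero>\<^bsub>M\<^esub>}" and faithful: "faithful_right_module R M"
  shows "embeds_in_division_ring R"
proof -
  obtain c :: "('c \<Rightarrow> 'c) \<Rightarrow> 'a list" where c: "inj_on c (carrier rational_closure)"
    by (rule inj_rational_closure_list)
  have "\<one>\<^bsub>rational_closure\<^esub> \<noteq> \<zero>\<^bsub>rational_closure\<^esub>"
  proof
    assume eq: "\<one>\<^bsub>rational_closure\<^esub> = \<zero>\<^bsub>rational_closure\<^esub>"
    have "m = \<zero>\<^bsub>M\<^esub>" if "m \<in> carrier M" for m
      using fun_cong[OF eq, of m] that by (simp add: rational_closure_simps)
    then show False using nz by blast
  qed
  then have skew: "skew_field (image_ring c rational_closure)"
    using rational_closure_inverse[OF E] by (intro skew_field_image_ring ring_rational_closure c) blast+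
  have "c \<in> ring_hom rational_closure (image_ring c rational_closure)"
    using inj_imp_image_ring_iso[OF c] by (simp add: ring_iso_def)
  then have "c \<circ> (\<lambda>r. \<lambda>m\<in>carrier M. m \<star>\<^bsub>M\<^esub> r) \<in> ring_hom R (image_ring c rational_closure)"
    by (rule ring_hom_trans[OF rsmult_ring_hom])
  moreover have "inj_on (c \<circ> (\<lambda>r. \<lambda>m\<in>carrier M. m \<star>\<^bsub>M\<^esub> r)) (carrier R)"
    using rsmult_mem_rational_closure
    by (intro comp_inj_on inj_on_rsmult faithful inj_on_subset[OF c]) auto
  ultimately show ?thesis unfolding embeds_in_division_ring_def using skew by blast
qed

theorem proposition16:
  fixes R :: "('a, 'p) ring_scheme" and M :: "('a, 'b, 'q) rmodule_scheme"
  assumes "right_module R M"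
  shows "(\<forall>N::nat. (\<forall>n. 0 < n \<and> n \<le> N \<longrightarrow> E_condition R M n) \<longrightarrow>
      (\<forall>n\<le>N. \<not> (\<exists>A \<in> mats_over R n (n - 1). \<exists>B \<in> mats_over R n n. \<exists>C \<in> mats_over R n n.
        adds_column A B \<and> adds_column A C \<and>
        ann_mat M C \<subset> ann_mat M B \<and> ann_mat M B \<subset> ann_mat M A)))
    \<and> ((\<forall>n>0. E_condition R M n) \<and> carrier M \<noteq> {\<zero>\<^bsub>M\<^esub>} \<and> faithful_right_module R M \<longrightarrow>
        embeds_in_division_ring R)"
proof -
  interpret right_module R M by (rule assms)
  show ?thesis
  proof (intro conjI allI impI)
    fix N n :: nat
    assume E: "\<forall>n. 0 < n \<and> n \<le> N \<longrightarrow> E_condition R M n" and "n \<le> N"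
    then have "E_condition R M k" if "0 < k" "k \<le> n" for k
      using that by auto
    then show "\<not> (\<exists>A \<in> mats_over R n (n - 1). \<exists>B \<in> mats_over R n n. \<exists>C \<in> mats_over R n n.
        adds_column A B \<and> adds_column A C \<and>
        ann_mat M C \<subset> ann_mat M B \<and> ann_mat M B \<subset> ann_mat M A)"
      using no_matrix_annihilator_chain[of n] by blast
  next
    assume "(\<forall>n>0. E_condition R M n) \<and> carrier M \<noteq> {\<zero>\<^bsub>M\<^esub>} \<and> faithful_right_module R M"
    then show "embeds_in_division_ring R"
      using embeds_in_division_ring_if_E_condition by blast
  qed
qed

end
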